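(* Let $X$ be a finite set of cardinality at least $3$, and let $S$ be the inverse semigroup associated to the group $S_X^{\mathbb N}$ acting self-similarly on $X^*$. Then the tight groupoid $\mathcal G_T(S)$ is Hausdorff, minimal and effective, and every isotropy group of $\mathcal G_T(S)$ is uncountable.
   Context: The action. $S_X$ is the symmetric group on $X$, $G=S_X^{\mathbb N}$ is the group of all sequences $\sigma=(\sigma_1,\sigma_2,\dots)$ in $S_X$, and $X^*$ is the free monoid on $X$. $G$ acts on $X^*$ by $\sigma(x_1\cdots x_k)=\sigma_1(x_1)\cdots\sigma_k(x_k)$; the section of $\sigma$ at a letter $x$ is $\sigma|_x=T(\sigma)$, where $T(\sigma)_i=\sigma_{i+1}$, and sections at words are defined by $g|_{\varepsilon}=g$, $g|_{xu}=(g|_x)|_u$. The associated inverse semigroup $S$ consists of $0$ and the formal elements $ugv^*$ ($u,v\in X^*$, $g\in G$, distinct triples giving distinct elements), with $0$ a zero and $(ugv^* )(whz^* )=(u\,g(w'))\,(g|_{w'}h)\,z^*$ if $w=vw'$; $(ugv^* )(whz^* )=u\,(g\,h|_{h^{-1}(v')})\,(z\,h^{-1}(v'))^*$ if $v=wv'$; and $0$ otherwise. Its inversion is $(ugv^* )^*=vg^{-1}u^*$. Tight groupoid. For an inverse semigroup $S$ with zero, $E(S)$ is the semilattice of idempotents and $s\le t$ means $s=ts^*s$. A character of $E(S)$ is a non-zero, zero-preserving homomorphism $\theta:E(S)\to\{0,1\}$; the set $\widehat{E(S)}$ of characters has the topology of pointwise convergence, and $D(e)=\{\theta:\theta(e)=1\}$.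 Elements $e_1,\dots,e_n\le e$ cover $e$ if for every $0\ne f\le e$ some $fe_i\ne0$. A character $\theta$ is tight if whenever $e_1,\dots,e_n$ cover $e$ and $\theta(e)=1$, some $\theta(e_i)=1$; $\widehat{E(S)}_T$ is the subspace of tight characters. $S$ acts by partial homeomorphisms $\beta_s:D(s^*s)\to D(ss^* )$, $\beta_s(\theta)(e)=\theta(s^*es)$. The universal groupoid $\mathcal G(S)$ has arrows the classes $[s,\theta]$ of pairs with $\theta\in D(s^*s)$, where $(s,\theta)\sim(t,\theta')$ iff $\theta=\theta'$ and there is $u\le s,t$ with $\theta\in D(u^*u)$; $d[s,\theta]=\theta$, $r[s,\theta]=\beta_s(\theta)$, $[s,\beta_t(\theta)][t,\theta]=[st,\theta]$, with basis of open sets $(s,U)=\{[s,\theta]:\theta\in U\}$, $U\subseteq D(s^*s)$ open. The tight groupoid $\mathcal G_T(S)$ is the restriction of $\mathcal G(S)$ to the closed invariant subspace $\widehat{E(S)}_T$. A groupoid $\mathcal G$ (identified with its set of arrows, unit space $\mathcal G^0$) is minimal if every orbit $\{r(g):d(g)=x\}$, $x\in\mathcal G^0$, is dense in $\mathcal G^0$; it is effective if the interior of $\{g:d(g)=r(g)\}$ equals $\mathcal G^0$. The isotropy group at $x\in\mathcal G^0$ is $\{g:d(g)=r(g)=x\}$. *)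

theory Defs
  imports "HOL-Analysis.Analysis" "HOL-Combinatorics.Perm"
begin

section \<open>Inverse semigroups with zero\<close>

class inverse_semigroup_0 = semigroup_mult + mult_zero +
  fixes star :: "'a \<Rightarrow> 'a"
  assumes mult_star_mult: "a * star a * a = a"
    and star_mult_star: "star a * a * star a = star a"
    and star_unique: "a * b * a = a \<Longrightarrow> b * a * b = b \<Longrightarrow> b = star a"

definition idems :: "'a::inverse_semigroup_0 set" where
  "idems = {e. e * e = e}"

definition natural_le :: "'a::inverse_semigroup_0 \<Rightarrow> 'a \<Rightarrow> bool" where
  "natural_le s t \<longleftrightarrow> s = t * star s * s"

lemma star_star [simp]: "star (star a) = (a :: 'a::inverse_semigroup_0)"
  using star_unique[of "star a" a] by (simp add: mult_star_mult star_mult_star)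

lemma star_idem: "e \<in> idems \<Longrightarrow> star e = e"
  using star_unique[of e e] by (simp add: idems_def)

lemma idems_mult:
  assumes "e \<in> idems" "f \<in> idems"
  shows "e * f \<in> idems"
proof -
  define x where "x = star (e * f)"
  have ee: "e * (e * z) = e * z" and ff: "f * (f * z) = f * z" for z
    using assms by (simp_all add: idems_def flip: mult.assoc)
  have 1: "e * (f * (x * (e * f))) = e * f"
    using mult_star_mult[of "e * f"] by (simp add: x_def mult.assoc)
  have 2: "x * (e * (f * x)) = x"
    using star_mult_star[of "e * f"] by (simp add: x_def mult.assoc)
  have 3: "x * (e * (f * (x * z))) = x * z" for z
    using arg_cong[OF 2, of "\<lambda>y. y * z"] by (simp add: mult.assoc)
  have "f * x * e = star (e * f)"
    by (rule star_unique) (simp_all add: mult.assoc ee ff 1 3)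
  then have x: "f * x * e = x"
    by (simp add: x_def)
  have "x * x = f * (x * (e * (f * (x * e))))"
    by (subst (1 2) x[symmetric]) (simp add: mult.assoc)
  also have "\<dots> = f * (x * e)"
    by (simp add: 3)
  also have "\<dots> = x"
    using x by (simp add: mult.assoc)
  finally have "x \<in> idems"
    by (simp add: idems_def)
  with star_idem[of x] show ?thesis
    by (simp add: x_def)
qed

lemma idems_commute:
  assumes "e \<in> idems" "f \<in> idems"
  shows "e * f = f * e"
proof -
  have ee: "e * (e * z) = e * z" and ff: "f * (f * z) = f * z" for z
    using assms by (simp_all add: idems_def flip: mult.assoc)
  have ef: "e * (f * (e * f)) = e * f" and fe: "f * (e * (f * e)) = f * e"
    using idems_mult[OF assms] idems_mult[OF assms(2,1)] by (simp_all add: idems_def mult.assoc)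
  have "f * e = star (e * f)"
    by (rule star_unique) (simp_all add: mult.assoc ee ff ef fe)
  also have "\<dots> = e * f"
    by (rule star_idem[OF idems_mult[OF assms]])
  finally show ?thesis by simp
qed

lemma star_mult_idems [simp]: "star s * s \<in> idems" "s * star s \<in> idems"
  by (simp_all add: idems_def mult.assoc[symmetric] mult_star_mult star_mult_star)

lemma star_mult_distrib:
  fixes a b :: "'a::inverse_semigroup_0"
  shows "star (a * b) = star b * star a"
proof -
  have c: "b * (star b * (star a * (a * z))) = star a * (a * (b * (star b * z)))" for z
    using arg_cong[OF idems_commute[OF star_mult_idems(2)[of b] star_mult_idems(1)[of a]],
        of "\<lambda>y. y * z"] by (simp add: mult.assoc)
  have c2: "star a * (a * (b * (star b * z))) = b * (star b * (star a * (a * z)))" for z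
    using c by simp
  have s: "a * (star a * (a * z)) = a * z" "star a * (a * (star a * z)) = star a * z" for a z :: 'a
    using arg_cong[OF mult_star_mult[of a], of "\<lambda>y. y * z"]
      arg_cong[OF star_mult_star[of a], of "\<lambda>y. y * z"] by (simp_all add: mult.assoc)
  have s': "b * (star b * b) = b" "star a * (a * star a) = star a" for a b :: 'a
    using mult_star_mult[of b] star_mult_star[of a] by (simp_all add: mult.assoc)
  have "star b * star a = star (a * b)"
  proof (rule star_unique)
    show "a * b * (star b * star a) * (a * b) = a * b"
      using c[of b] by (simp add: mult.assoc s s')
    show "star b * star a * (a * b) * (star b * star a) = star b * star a"
      using c2[of "star a"] by (simp add: mult.assoc s s')
  qed
  then show ?thesis by simp
qed

lemma natural_le_iff: "natural_le u s \<longleftrightarrow> (\<exists>e\<in>idems. u = s * e)"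
proof
  assume "natural_le u s"
  then have "u = s * (star u * u)" by (simp add: natural_le_def mult.assoc)
  then show "\<exists>e\<in>idems. u = s * e" using star_mult_idems(1) by blast
next
  assume "\<exists>e\<in>idems. u = s * e"
  then obtain e where e: "e \<in> idems" "u = s * e" by blast
  have "s * star u * u = s * (e * (star s * s)) * e"
    using e by (simp add: star_mult_distrib star_idem mult.assoc)
  also have "\<dots> = s * star s * s * (e * e)"
    using idems_commute[OF e(1) star_mult_idems(1)[of s]] by (simp add: mult.assoc)
  also have "\<dots> = u"
    using e by (simp add: mult_star_mult idems_def)
  finally show "natural_le u s" by (simp add: natural_le_def)
qed

lemma zero_idems [simp]: "0 \<in> idems"
  by (simp add: idems_def)

lemma conj_idems [simp]: "e \<in> idems \<Longrightarrow> star s * e * s \<in> idems"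
proof -
  assume e: "e \<in> idems"
  have "star s * e * s * (star s * e * s) = star s * (e * (s * star s)) * e * s"
    by (simp add: mult.assoc)
  also have "\<dots> = (star s * s * star s) * (e * e) * s"
    using idems_commute[OF e star_mult_idems(2)[of s]] by (simp add: mult.assoc)
  also have "\<dots> = star s * e * s"
    using e by (simp add: star_mult_star idems_def)
  finally show ?thesis by (simp add: idems_def)
qed


section \<open>Topological groupoids\<close>

text \<open>The set of arrows is \<open>topspace (arrow_topology G)\<close>; the unit space is
  \<open>topspace (unit_topology G)\<close> and is embedded in the arrows by \<open>unit_arrow G\<close>.
  The product \<open>comp G a b\<close> is meaningful if \<open>src G a = tgt G b\<close>.\<close>

record ('o, 'a) top_groupoid =
  unit_topology :: "'o topology"
  arrow_topology :: "'a topology"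
  src :: "'a \<Rightarrow> 'o"
  tgt :: "'a \<Rightarrow> 'o"
  unit_arrow :: "'o \<Rightarrow> 'a"
  comp :: "'a \<Rightarrow> 'a \<Rightarrow> 'a"

abbreviation units :: "('o, 'a) top_groupoid \<Rightarrow> 'o set" where
  "units G \<equiv> topspace (unit_topology G)"

abbreviation arrows :: "('o, 'a) top_groupoid \<Rightarrow> 'a set" where
  "arrows G \<equiv> topspace (arrow_topology G)"

definition groupoid_orbit :: "('o, 'a) top_groupoid \<Rightarrow> 'o \<Rightarrow> 'o set" where
  "groupoid_orbit G x = {tgt G g | g. g \<in> arrows G \<and> src G g = x}"

definition isotropy :: "('o, 'a) top_groupoid \<Rightarrow> 'o \<Rightarrow> 'a set" where
  "isotropy G x = {g \<in> arrows G. src G g = x \<and> tgt G g = x}"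

definition minimal_groupoid :: "('o, 'a) top_groupoid \<Rightarrow> bool" where
  "minimal_groupoid G \<longleftrightarrow>
     (\<forall>x\<in>units G. unit_topology G closure_of groupoid_orbit G x = units G)"

definition effective_groupoid :: "('o, 'a) top_groupoid \<Rightarrow> bool" where
  "effective_groupoid G \<longleftrightarrow>
     arrow_topology G interior_of {g \<in> arrows G. src G g = tgt G g} = unit_arrow G ` units G"

definition hausdorff_groupoid :: "('o, 'a) top_groupoid \<Rightarrow> bool" where
  "hausdorff_groupoid G \<longleftrightarrow> Hausdorff_space (arrow_topology G)"

definition restrict_groupoid :: "('o, 'a) top_groupoid \<Rightarrow> 'o set \<Rightarrow> ('o, 'a) top_groupoid" where
  "restrict_groupoid G Y =
     G\<lparr>unit_topology := subtopology (unit_topology G) Y,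
       arrow_topology := subtopology (arrow_topology G) {g. src G g \<in> Y \<and> tgt G g \<in> Y}\<rparr>"


section \<open>Characters\<close>

text \<open>Maps from the idempotents to \<open>{0,1}\<close> are represented by Boolean functions which are
  \<^const>\<open>extensional\<close> on \<^const>\<open>idems\<close>; this makes them points of \<^const>\<open>product_topology\<close>,
  whose topology is that of pointwise convergence.\<close>

type_synonym 's character = "'s \<Rightarrow> bool"

definition characters :: "'s::inverse_semigroup_0 character set" where
  "characters = {\<theta> \<in> extensional idems.
     \<not> \<theta> 0 \<and> (\<exists>e\<in>idems. \<theta> e) \<and> (\<forall>e\<in>idems. \<forall>f\<in>idems. \<theta> (e * f) \<longleftrightarrow> \<theta> e \<and> \<theta> f)}"

definition character_topology :: "'s::inverse_semigroup_0 character topology" where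
  "character_topology =
     subtopology (product_topology (\<lambda>_. discrete_topology UNIV) idems) characters"

definition char_dom :: "'s::inverse_semigroup_0 \<Rightarrow> 's character set" where
  "char_dom e = {\<theta> \<in> characters. \<theta> e}"

definition covers :: "'s::inverse_semigroup_0 set \<Rightarrow> 's \<Rightarrow> bool" where
  "covers C e \<longleftrightarrow> finite C \<and> C \<subseteq> {c \<in> idems. natural_le c e} \<and>
     (\<forall>f\<in>idems. f \<noteq> 0 \<and> natural_le f e \<longrightarrow> (\<exists>c\<in>C. f * c \<noteq> 0))"

definition tight_characters :: "'s::inverse_semigroup_0 character set" where
  "tight_characters = {\<theta> \<in> characters.
     \<forall>e\<in>idems. \<forall>C. covers C e \<and> \<theta> e \<longrightarrow> (\<exists>c\<in>C. \<theta> c)}"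

definition char_act :: "'s::inverse_semigroup_0 \<Rightarrow> 's character \<Rightarrow> 's character" where
  "char_act s \<theta> = (\<lambda>e\<in>idems. \<theta> (star s * e * s))"

lemma topspace_character_topology: "topspace character_topology = characters"
  by (auto simp: character_topology_def characters_def PiE_UNIV_domain PiE_def)

lemma characters_mult:
  "\<theta> \<in> characters \<Longrightarrow> e \<in> idems \<Longrightarrow> f \<in> idems \<Longrightarrow> \<theta> (e * f) \<longleftrightarrow> \<theta> e \<and> \<theta> f"
  unfolding characters_def by blast

lemma char_act_char_dom:
  assumes "\<theta> \<in> char_dom (star s * s)"
  shows "char_act s \<theta> \<in> char_dom (s * star s)"
proof -
  have \<theta>: "\<theta> \<in> characters" "\<theta> (star s * s)"
    using assms by (auto simp: char_dom_def)
  have s: "star s * (s * star s) * s = star s * s"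
    by (simp add: mult_star_mult star_mult_star flip: mult.assoc)
  have m: "\<theta> (star s * (e * f) * s) \<longleftrightarrow> \<theta> (star s * e * s) \<and> \<theta> (star s * f * s)"
    if e: "e \<in> idems" and f: "f \<in> idems" for e f
  proof -
    have "star s * e * s * (star s * f * s) = star s * (e * (s * star s)) * f * s"
      by (simp add: mult.assoc)
    also have "\<dots> = (star s * s * star s) * (e * f) * s"
      using idems_commute[OF e star_mult_idems(2)[of s]] by (simp add: mult.assoc)
    finally show ?thesis
      using characters_mult[OF \<theta>(1) conj_idems[OF e, of s] conj_idems[OF f, of s]]
      by (simp add: star_mult_star)
  qed
  have "\<not> \<theta> 0" using \<theta> by (auto simp: characters_def)
  have v: "char_act s \<theta> e \<longleftrightarrow> \<theta> (star s * e * s)" if "e \<in> idems" for e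
    using that by (simp add: char_act_def)
  have ss: "char_act s \<theta> (s * star s)"
    unfolding v[OF star_mult_idems(2)] s by (rule \<theta>(2))
  then have "char_act s \<theta> \<in> characters"
    unfolding characters_def using \<open>\<not> \<theta> 0\<close> star_mult_idems(2)[of s]
    by (auto simp: v idems_mult m) (auto simp: char_act_def)
  with ss show ?thesis by (simp add: char_dom_def)
qed


section \<open>The universal and the tight groupoid\<close>

type_synonym 's germ_class = "('s \<times> 's character) set"

definition germ_pairs :: "('s::inverse_semigroup_0 \<times> 's character) set" where
  "germ_pairs = {(s, \<theta>). \<theta> \<in> char_dom (star s * s)}"

definition germ_rel :: "(('s::inverse_semigroup_0 \<times> 's character) \<times> ('s \<times> 's character)) set" where
  "germ_rel = {((s, \<theta>), (t, \<theta>')). (s, \<theta>) \<in> germ_pairs \<and> (t, \<theta>') \<in> germ_pairs \<and> \<theta> = \<theta>' \<and>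
     (\<exists>u. natural_le u s \<and> natural_le u t \<and> \<theta> \<in> char_dom (star u * u))}"

definition germ :: "'s::inverse_semigroup_0 \<Rightarrow> 's character \<Rightarrow> 's germ_class" where
  "germ s \<theta> = germ_rel `` {(s, \<theta>)}"

definition basic_bisection :: "'s::inverse_semigroup_0 \<Rightarrow> 's character set \<Rightarrow> 's germ_class set" where
  "basic_bisection s U = germ s ` U"

text \<open>The uses of \<^const>\<open>the_elem\<close> below express that a value does not depend on the
  choice of representatives.  The type argument selects the inverse semigroup.\<close>

definition universal_groupoid ::
    "'s::inverse_semigroup_0 itself \<Rightarrow> ('s character, 's germ_class) top_groupoid" where
  "universal_groupoid _ =
     \<lparr>unit_topology = character_topology,
      arrow_topology = topology_generated_by
        {basic_bisection s U | s U. openin character_topology U \<and> U \<subseteq> char_dom (star s * s)},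
      src = (\<lambda>g. the_elem {\<theta> | s \<theta>. (s, \<theta>) \<in> g}),
      tgt = (\<lambda>g. the_elem {char_act s \<theta> | s \<theta>. (s, \<theta>) \<in> g}),
      unit_arrow = (\<lambda>\<theta>. the_elem {germ e \<theta> | e. e \<in> idems \<and> \<theta> e}),
      comp = (\<lambda>g h. the_elem
        {germ (s * t) \<theta> | s t \<theta>. (s, char_act t \<theta>) \<in> g \<and> (t, \<theta>) \<in> h})\<rparr>"

definition tight_groupoid ::
    "'s::inverse_semigroup_0 itself \<Rightarrow> ('s character, 's germ_class) top_groupoid" where
  "tight_groupoid S = restrict_groupoid (universal_groupoid S) tight_characters"

lemma germ_relI:
  assumes "(s, \<theta>) \<in> germ_pairs" "(t, \<theta>) \<in> germ_pairs"
    "e \<in> idems" "\<theta> e" "s * e = t * e"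
  shows "((s, \<theta>), (t, \<theta>)) \<in> germ_rel"
proof -
  have "star (s * e) * (s * e) = e * (star s * s) * e"
    using assms(3) by (simp add: star_mult_distrib star_idem mult.assoc)
  then have "\<theta> \<in> char_dom (star (s * e) * (s * e))"
    using assms by (auto simp: germ_pairs_def char_dom_def characters_mult idems_mult)
  moreover have "natural_le (s * e) s"
    using assms(3) by (auto simp: natural_le_iff)
  moreover have "natural_le (s * e) t"
    using assms(3,5) by (auto simp: natural_le_iff)
  ultimately show ?thesis
    using assms by (auto simp: germ_rel_def)
qed

lemma germ_relE:
  assumes "((s, \<theta>), (t, \<theta>')) \<in> germ_rel"
  obtains e where "(s, \<theta>) \<in> germ_pairs" "(t, \<theta>') \<in> germ_pairs" "\<theta>' = \<theta>"
    "e \<in> idems" "\<theta> e" "s * e = t * e"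
proof -
  obtain u where u: "natural_le u s" "natural_le u t" "\<theta> \<in> char_dom (star u * u)"
    using assms by (auto simp: germ_rel_def)
  have "s * (star u * u) = u" "t * (star u * u) = u"
    using u by (simp_all add: natural_le_def mult.assoc)
  then have eq: "s * (star u * u) = t * (star u * u)"
    by simp
  have *: "(s, \<theta>) \<in> germ_pairs" "(t, \<theta>') \<in> germ_pairs" "\<theta>' = \<theta>"
    using assms by (auto simp: germ_rel_def)
  have "\<theta> (star u * u)"
    using u(3) by (simp add: char_dom_def)
  with * show thesis
    by (rule that[OF _ _ _ star_mult_idems(1) _ eq])
qed

lemma equiv_germ_rel: "equiv germ_pairs germ_rel"
proof (rule equivI)
  show "refl_on germ_pairs germ_rel"
    by (auto simp: refl_on_def germ_pairs_def char_dom_def intro!: germ_relI star_mult_idems(1))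
  show "sym germ_rel"
    by (auto simp: sym_def germ_rel_def)
  show "trans germ_rel"
  proof (rule transI, clarify)
    fix r \<theta> s \<theta>' t \<theta>''
    assume 1: "((r, \<theta>), (s, \<theta>')) \<in> germ_rel" and 2: "((s, \<theta>'), (t, \<theta>'')) \<in> germ_rel"
    obtain e where e: "(r, \<theta>) \<in> germ_pairs" "\<theta>' = \<theta>" "e \<in> idems" "\<theta> e" "r * e = s * e"
      using germ_relE[OF 1] by metis
    obtain f where f: "(t, \<theta>'') \<in> germ_pairs" "\<theta>'' = \<theta>'" "f \<in> idems" "\<theta>' f" "s * f = t * f"
      using germ_relE[OF 2] by metis
    have "r * (e * f) = s * f * e"
      using e f idems_commute[of e f] by (metis mult.assoc)
    also have "\<dots> = t * (e * f)"
      using e f idems_commute[of e f] by (metis mult.assoc)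
    finally show "((r, \<theta>), (t, \<theta>'')) \<in> germ_rel"
      using e f by (auto intro!: germ_relI[where e = "e * f"]
          simp: idems_mult characters_mult germ_pairs_def char_dom_def)
  qed
qed (auto simp: germ_rel_def)

lemma germ_eq_iff:
  "(s, \<theta>) \<in> germ_pairs \<Longrightarrow> (t, \<theta>') \<in> germ_pairs \<Longrightarrow>
    germ s \<theta> = germ t \<theta>' \<longleftrightarrow> ((s, \<theta>), (t, \<theta>')) \<in> germ_rel"
  unfolding germ_def by (rule eq_equiv_class_iff[OF equiv_germ_rel])

lemma in_germ_iff: "(t, \<theta>') \<in> germ s \<theta> \<longleftrightarrow> ((s, \<theta>), (t, \<theta>')) \<in> germ_rel"
  by (simp add: germ_def)

lemma in_germ_self: "(s, \<theta>) \<in> germ_pairs \<Longrightarrow> (s, \<theta>) \<in> germ s \<theta>"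
  using equiv_class_self[OF equiv_germ_rel] by (simp add: germ_def)

lemma char_act_cong:
  assumes "((s, \<theta>), (t, \<theta>')) \<in> germ_rel"
  shows "char_act s \<theta> = char_act t \<theta>'"
proof -
  obtain e where e: "(s, \<theta>) \<in> germ_pairs" "\<theta>' = \<theta>" "e \<in> idems" "\<theta> e" "s * e = t * e"
    using germ_relE[OF assms] by metis
  then have \<theta>: "\<theta> \<in> characters" by (simp add: germ_pairs_def char_dom_def)
  have r: "\<theta> (star r * f * r) \<longleftrightarrow> \<theta> (star (r * e) * f * (r * e))" if "f \<in> idems" for r f
  proof -
    have "star (r * e) * f * (r * e) = e * (star r * f * r) * e"
      using e(3) by (simp add: star_mult_distrib star_idem mult.assoc)
    then show ?thesis
      using \<theta> e(3,4) that by (simp add: characters_mult idems_mult)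
  qed
  show ?thesis
    using r[of _ s] r[of _ t] e(2,5) by (auto simp: char_act_def restrict_def fun_eq_iff)
qed

lemma src_germ: "(s, \<theta>) \<in> germ_pairs \<Longrightarrow> src (universal_groupoid S) (germ s \<theta>) = \<theta>"
proof -
  assume "(s, \<theta>) \<in> germ_pairs"
  then have "{\<theta>' | t \<theta>'. (t, \<theta>') \<in> germ s \<theta>} = {\<theta>}"
    using in_germ_self[of s \<theta>] by (auto simp: in_germ_iff elim: germ_relE)
  then show ?thesis by (simp add: universal_groupoid_def)
qed

lemma tgt_germ: "(s, \<theta>) \<in> germ_pairs \<Longrightarrow> tgt (universal_groupoid S) (germ s \<theta>) = char_act s \<theta>"
proof -
  assume "(s, \<theta>) \<in> germ_pairs"
  then have self: "(s, \<theta>) \<in> germ s \<theta>"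
    by (rule in_germ_self)
  have "char_act t \<theta>' = char_act s \<theta>" if "(t, \<theta>') \<in> germ s \<theta>" for t \<theta>'
    using char_act_cong[OF that[unfolded in_germ_iff]] by (rule sym)
  with self have "{char_act t \<theta>' | t \<theta>'. (t, \<theta>') \<in> germ s \<theta>} = {char_act s \<theta>}"
    by blast
  then show ?thesis by (simp add: universal_groupoid_def)
qed

lemma idem_germ_pairs:
  "\<theta> \<in> characters \<Longrightarrow> e \<in> idems \<Longrightarrow> (e, \<theta>) \<in> germ_pairs \<longleftrightarrow> \<theta> e"
  unfolding germ_pairs_def char_dom_def by (simp add: star_idem) (simp add: idems_def)

lemma unit_arrow_eq:
  assumes "\<theta> \<in> characters" "e \<in> idems" "\<theta> e"
  shows "unit_arrow (universal_groupoid S) \<theta> = germ e \<theta>"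
proof -
  have "germ f \<theta> = germ e \<theta>" if "f \<in> idems" "\<theta> f" for f
  proof -
    have "f * (e * f) = e * (e * f)"
      using assms(2) that(1) idems_commute[of e f] by (auto simp: idems_def) (metis mult.assoc)
    then show ?thesis
      using assms that germ_relI[of f \<theta> e "e * f"]
      by (simp add: germ_eq_iff idem_germ_pairs idems_mult characters_mult)
  qed
  then have "{germ e \<theta> | e. e \<in> idems \<and> \<theta> e} = {germ e \<theta>}"
    using assms by blast
  then show ?thesis by (simp add: universal_groupoid_def)
qed

lemma comp_germ:
  assumes "(t, \<theta>) \<in> germ_pairs" "(s, char_act t \<theta>) \<in> germ_pairs"
  shows "comp (universal_groupoid S) (germ s (char_act t \<theta>)) (germ t \<theta>) = germ (s * t) \<theta>"
proof -
  have pair: "(s * t, \<theta>) \<in> germ_pairs"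
    if "(t, \<theta>) \<in> germ_pairs" "(s, char_act t \<theta>) \<in> germ_pairs" for s t :: 'a and \<theta>
  proof -
    have "star (s * t) * (s * t) = star t * (star s * s) * t"
      by (simp add: star_mult_distrib mult.assoc)
    moreover have "\<theta> (star t * (star s * s) * t)"
      using that(2) star_mult_idems(1)[of s] by (auto simp: germ_pairs_def char_dom_def char_act_def)
    ultimately show ?thesis
      using that(1) by (auto simp: germ_pairs_def char_dom_def)
  qed
  have eq: "germ (s' * t') \<theta>' = germ (s * t) \<theta>"
    if 1: "((s, char_act t \<theta>), (s', char_act t' \<theta>')) \<in> germ_rel"
      and 2: "((t, \<theta>), (t', \<theta>')) \<in> germ_rel" for s' t' \<theta>'
  proof -
    obtain e where e: "(s', char_act t' \<theta>') \<in> germ_pairs" "e \<in> idems" "char_act t \<theta> e" "s * e = s' * e"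
      using germ_relE[OF 1] by metis
    obtain f where f: "(t', \<theta>') \<in> germ_pairs" "\<theta>' = \<theta>" "f \<in> idems" "\<theta> f" "t * f = t' * f"
      using germ_relE[OF 2] by metis
    define k where "k = f * (star t * e * t)"
    have k: "k \<in> idems" "\<theta> k"
    proof -
      have te: "star t * e * t \<in> idems" "\<theta> (star t * e * t)"
        using e(2,3) by (auto simp: char_act_def)
      have "\<theta> \<in> characters"
        using assms(1) by (simp add: germ_pairs_def char_dom_def)
      then show "k \<in> idems" "\<theta> k"
        using te f(3,4) unfolding k_def by (simp_all add: idems_mult characters_mult)
    qed
    have kf: "k = (star t * e * t) * f"
      unfolding k_def by (rule idems_commute[OF f(3) conj_idems[OF e(2)]])
    have tk: "t * k = e * t * f"
    proof -
      have "t * k = (t * star t) * e * t * f" by (simp add: kf mult.assoc)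
      also have "\<dots> = e * (t * star t * t) * f"
        using idems_commute[OF e(2) star_mult_idems(2)[of t]] by (simp add: mult.assoc[symmetric])
      finally show ?thesis by (simp add: mult_star_mult)
    qed
    have tk': "t' * k = t * k"
    proof -
      have "f * k = k" using f(3) by (simp add: k_def idems_def mult.assoc[symmetric])
      then show ?thesis using f(5) by (metis mult.assoc)
    qed
    have "s * t * k = s' * t' * k"
      using tk tk' e(4) by (metis mult.assoc)
    then have "((s * t, \<theta>), (s' * t', \<theta>)) \<in> germ_rel"
      using pair[OF assms] pair[OF f(1) e(1)] f(2) k by (auto intro!: germ_relI)
    then show ?thesis
      using equiv_class_eq[OF equiv_germ_rel] f(2) unfolding germ_def by metis
  qed
  have eq: "germ (s' * t') \<theta>' = germ (s * t) \<theta>"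
    if "(s', char_act t' \<theta>') \<in> germ s (char_act t \<theta>)" "(t', \<theta>') \<in> germ t \<theta>" for s' t' \<theta>'
    by (rule eq[OF that[unfolded in_germ_iff]])
  have "{germ (s' * t') \<theta>' | s' t' \<theta>'. (s', char_act t' \<theta>') \<in> germ s (char_act t \<theta>) \<and>
      (t', \<theta>') \<in> germ t \<theta>} = {germ (s * t) \<theta>}" (is "?A = _")
  proof
    show "?A \<subseteq> {germ (s * t) \<theta>}"
      using eq by blast
    show "{germ (s * t) \<theta>} \<subseteq> ?A"
      using in_germ_self[OF assms(1)] in_germ_self[OF assms(2)]
      by (intro subsetI CollectI exI[of _ s] exI[of _ t] exI[of _ \<theta>]) simp
  qed
  then show ?thesis
    by (simp only: universal_groupoid_def top_groupoid.select_convs the_elem_eq)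
qed


section \<open>Sequences of permutations acting on words\<close>

text \<open>For a finite type \<open>'x\<close>, the type \<open>'x perm\<close> is the full symmetric group, with
  composition of maps as product.  Sequences are indexed from 0.\<close>

type_synonym 'x perm_seq = "nat \<Rightarrow> 'x perm"

definition seq_mult :: "'x perm_seq \<Rightarrow> 'x perm_seq \<Rightarrow> 'x perm_seq" where
  "seq_mult g h = (\<lambda>i. g i * h i)"

definition seq_inv :: "'x perm_seq \<Rightarrow> 'x perm_seq" where
  "seq_inv g = (\<lambda>i. inverse (g i))"

definition letter_section :: "'x perm_seq \<Rightarrow> 'x \<Rightarrow> 'x perm_seq" where
  "letter_section g x = (\<lambda>i. g (Suc i))"

primrec word_section :: "'x perm_seq \<Rightarrow> 'x list \<Rightarrow> 'x perm_seq" where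
  "word_section g [] = g"
| "word_section g (x # u) = word_section (letter_section g x) u"

definition word_act :: "'x perm_seq \<Rightarrow> 'x list \<Rightarrow> 'x list" where
  "word_act g w = map2 (\<lambda>i x. Perm.apply (g i) x) [0..<length w] w"


section \<open>The associated inverse semigroup\<close>

text \<open>\<open>Elt u g v\<close> is the formal element \<open>u g v\<^sup>*\<close>.\<close>

datatype 'x isg = Zero | Elt "'x list" "'x perm_seq" "'x list"

lemma length_word_act [simp]: "length (word_act g w) = length w"
  by (simp add: word_act_def)

lemma word_act_Nil [simp]: "word_act g [] = []"
  by (simp add: word_act_def)

lemma word_act_Cons [simp]:
  "word_act g (x # w) = Perm.apply (g 0) x # word_act (letter_section g x) w"
  by (rule nth_equalityI) (auto simp: word_act_def letter_section_def nth_Cons' simp del: upt_Suc)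

lemma word_act_append: "word_act g (v @ w) = word_act g v @ word_act (word_section g v) w"
  by (induction v arbitrary: g) auto

lemma word_act_mult: "word_act (seq_mult g h) w = word_act g (word_act h w)"
  by (auto simp: word_act_def seq_mult_def apply_times intro!: nth_equalityI)

lemma word_act_inv [simp]:
  "word_act (seq_inv g) (word_act g w) = w" "word_act g (word_act (seq_inv g) w) = w"
  by (auto simp: word_act_def seq_inv_def apply_sequence intro!: nth_equalityI)

lemma word_act_eq_iff: "word_act g v = word_act g w \<longleftrightarrow> v = w"
  by (metis word_act_inv(1))

lemma word_act_faithful:
  assumes "\<And>w. word_act g w = word_act h w"
  shows "g = h"
proof
  fix i
  show "g i = h i"
  proof (rule perm_eqI)
    fix x
    show "Perm.apply (g i) x = Perm.apply (h i) x"
      using arg_cong[OF assms[of "replicate (Suc i) x"], of "\<lambda>w. w ! i"]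
      by (simp add: word_act_def del: upt_Suc replicate_Suc)
  qed
qed

instantiation isg :: (finite) inverse_semigroup_0
begin

definition zero_isg :: "'a isg" where
  "zero_isg = Zero"

text \<open>If \<open>v = w\<close> then both nontrivial clauses of the product apply, and they agree.\<close>

definition times_isg :: "'a isg \<Rightarrow> 'a isg \<Rightarrow> 'a isg" where
  "times_isg a b =
     (case (a, b) of
        (Elt u g v, Elt w h z) \<Rightarrow>
          if \<exists>w'. w = v @ w' then
            let w' = drop (length v) w
            in Elt (u @ word_act g w') (seq_mult (word_section g w') h) z
          else if \<exists>v'. v = w @ v' then
            let y = word_act (seq_inv h) (drop (length w) v)
            in Elt u (seq_mult g (word_section h y)) (z @ y)
          else Zero
      | _ \<Rightarrow> Zero)"

definition star_isg :: "'a isg \<Rightarrow> 'a isg" where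
  "star_isg a = (case a of Zero \<Rightarrow> Zero | Elt u g v \<Rightarrow> Elt v (seq_inv g) u)"

text \<open>The inverse semigroup laws are obtained from the faithful representation of \<open>u g v\<^sup>*\<close>
  as the partial bijection \<open>v y \<mapsto> u g(y)\<close> of the set of words.\<close>

definition isg_map :: "'a isg \<Rightarrow> 'a list \<Rightarrow> 'a list option" where
  "isg_map a y = (case a of Zero \<Rightarrow> None
     | Elt u g v \<Rightarrow> if \<exists>w. y = v @ w then Some (u @ word_act g (drop (length v) y)) else None)"

lemma isg_map_Zero [simp]: "isg_map Zero = Map.empty"
  by (simp add: isg_map_def fun_eq_iff)

lemma isg_map_Elt_eq_Some:
  "isg_map (Elt u g v) y = Some x \<longleftrightarrow> (\<exists>w. y = v @ w \<and> x = u @ word_act g w)"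
  by (auto simp: isg_map_def)

lemma isg_map_inject:
  fixes a b :: "'a isg"
  assumes "isg_map a = isg_map b"
  shows "a = b"
proof -
  have ne: "isg_map (Elt u g v) \<noteq> Map.empty" for u g and v :: "'a list"
    by (metis isg_map_Elt_eq_Some append_Nil2 option.distinct(1))
  have inj: "u = u' \<and> g = g' \<and> v = v'" if eq: "isg_map (Elt u g v) = isg_map (Elt u' g' v')"
    for u g v u' g' and v' :: "'a list"
  proof -
    have *: "(\<exists>w. y = v @ w \<and> x = u @ word_act g w) \<longleftrightarrow>
        (\<exists>w. y = v' @ w \<and> x = u' @ word_act g' w)" for x y
      using eq by (metis isg_map_Elt_eq_Some)
    have v: "v = v'"
      using *[of v "u @ word_act g []"] *[of v' "u' @ word_act g' []"] by auto
    have u: "u = u'"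
      using *[of v "u @ word_act g []"] v by simp
    have "word_act g w = word_act g' w" for w
      using *[of "v @ w" "u @ word_act g w"] u v by simp
    then show ?thesis using u v word_act_faithful by blast
  qed
  show ?thesis
    using assms by (cases a; cases b) (auto simp: ne ne[symmetric] dest: inj)
qed

lemma isg_map_times:
  fixes a b :: "'a isg"
  shows "isg_map (a * b) = isg_map a \<circ>\<^sub>m isg_map b"
proof (cases "a = Zero \<or> b = Zero")
  case True
  then show ?thesis
    by (auto simp: times_isg_def map_comp_def fun_eq_iff split: isg.splits option.splits)
next
  case False
  then obtain u g v w h z where ab: "a = Elt u g v" "b = Elt w h z"
    by (metis isg.exhaust)
  have comp: "(isg_map a \<circ>\<^sub>m isg_map b) y = Some x \<longleftrightarrow>
      (\<exists>p q. y = z @ p \<and> w @ word_act h p = v @ q \<and> x = u @ word_act g q)" for x y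
    by (auto simp: ab map_comp_Some_iff isg_map_Elt_eq_Some)
  have "isg_map (a * b) y = Some x \<longleftrightarrow> (isg_map a \<circ>\<^sub>m isg_map b) y = Some x" for x y
  proof -
    consider (1) w' where "w = v @ w'" | (2) v' where "v = w @ v'" "\<not> (\<exists>w'. w = v @ w')"
      | (3) "\<not> (\<exists>w'. w = v @ w')" "\<not> (\<exists>v'. v = w @ v')" by blast
    then show ?thesis
    proof cases
      case 1
      then show ?thesis
        unfolding comp
        by (auto simp: ab times_isg_def isg_map_Elt_eq_Some word_act_append word_act_mult)
    next
      case 2
      define r where "r = word_act (seq_inv h) v'"
      have hr: "word_act h r = v'" by (simp add: r_def)
      have "word_act h p = v' @ q \<longleftrightarrow> (\<exists>p'. p = r @ p' \<and> q = word_act (word_section h r) p')" for p q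
      proof
        assume p: "word_act h p = v' @ q"
        have "word_act h p = word_act h (r @ word_act (seq_inv (word_section h r)) q)"
          by (simp add: p word_act_append hr)
        then show "\<exists>p'. p = r @ p' \<and> q = word_act (word_section h r) p'"
          by (auto simp: word_act_eq_iff)
      qed (auto simp: word_act_append hr)
      then have *: "w @ word_act h p = v @ q \<longleftrightarrow>
          (\<exists>p'. p = r @ p' \<and> q = word_act (word_section h r) p')" for p q
        by (simp add: 2)
      have m: "a * b = Elt u (seq_mult g (word_section h r)) (z @ r)"
        using 2 by (simp add: ab times_isg_def r_def Let_def)
      show ?thesis
        unfolding comp * m isg_map_Elt_eq_Some word_act_mult by auto
    next
      case 3
      then have "w @ p \<noteq> v @ q" for p q
        by (metis append_eq_append_conv2)
      with 3 show ?thesis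
        unfolding comp by (simp add: ab times_isg_def)
    qed
  qed
  then show ?thesis
    by (metis ext not_None_eq)
qed

lemma isg_map_star:
  fixes a :: "'a isg"
  shows "isg_map (star a) x = Some y \<longleftrightarrow> isg_map a y = Some x"
  by (cases a) (auto simp: star_isg_def isg_map_Elt_eq_Some)

instance
proof
  fix a b c :: "'a isg"
  show "a * b * c = a * (b * c)"
    by (rule isg_map_inject) (auto simp: isg_map_times map_comp_def fun_eq_iff split: option.splits)
  show "0 * a = 0" "a * 0 = 0"
    by (auto simp: zero_isg_def times_isg_def split: isg.splits)
  have inj: "y = y'" if "isg_map a y = Some x" "isg_map a y' = Some x" for a :: "'a isg" and x y y'
    using that by (cases a) (auto simp: isg_map_Elt_eq_Some word_act_eq_iff)
  have eqI: "a = b" if "\<And>x y. isg_map a y = Some x \<longleftrightarrow> isg_map b y = Some x" for a b :: "'a isg"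
    using that by (intro isg_map_inject) (metis ext not_None_eq)
  have t: "isg_map (a * b) y = Some x \<longleftrightarrow> (\<exists>z. isg_map b y = Some z \<and> isg_map a z = Some x)"
    for a b :: "'a isg" and x y
    by (simp add: isg_map_times map_comp_Some_iff)
  show "a * star a * a = a" "star a * a * star a = star a"
    by (rule eqI; auto simp: t isg_map_star)+
  show "b = star a" if "a * b * a = a" "b * a * b = b"
  proof -
    have 1: "isg_map b y = Some x" if "isg_map a x = Some y" for x y
    proof -
      obtain x' where "isg_map b y = Some x'" "isg_map a x' = Some y"
        using \<open>isg_map a x = Some y\<close> \<open>a * b * a = a\<close> t[of "a * b" a x y] t[of a b] by auto
      then show ?thesis using inj \<open>isg_map a x = Some y\<close> by metis
    qed
    have 2: "isg_map a x = Some y" if "isg_map b y = Some x" for x y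
    proof -
      obtain y' where "isg_map a x = Some y'" "isg_map b y' = Some x"
        using \<open>isg_map b y = Some x\<close> \<open>b * a * b = b\<close> t[of "b * a" b y x] t[of b a] by auto
      then show ?thesis using inj \<open>isg_map b y = Some x\<close> by metis
    qed
    show ?thesis
      by (rule eqI) (use 1 2 isg_map_star in blast)
  qed
qed

end

end

theory Submission
  imports Defs "HOL-Library.Stream"
begin

text \<open>The tight characters are exactly the characters of infinite words \<open>p\<close>, with the cylinders of the
  prefixes of \<open>p\<close> as their filter, and \<open>u g v\<^sup>*\<close> acts by \<open>v q \<mapsto> u g(q)\<close>.  Two germs \<open>A g w\<^sup>*\<close> and
  \<open>B h w\<^sup>*\<close> at \<open>w q\<close> agree iff, for some \<open>n\<close>, the prefix \<open>q\<^sub>n\<close> of length \<open>n\<close> of \<open>q\<close> satisfies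
  \<open>A g(q\<^sub>n) = B h(q\<^sub>n)\<close> and \<open>g\<close>, \<open>h\<close> agree from index \<open>n\<close> on.  This is a clopen condition on \<open>q\<close>,
  whence the Hausdorff property.  Orbits contain all \<open>u p\<close>, hence are dense.  If \<open>A g(q) = w q\<close> for
  all \<open>q\<close> then \<open>A = w\<close> and \<open>g = 1\<close>, which is effectiveness.  With three letters every point
  stabilizer in the symmetric group is nontrivial, so uncountably many sequences that pairwise
  differ infinitely often fix \<open>p\<close>.\<close>

section \<open>The topology of the universal groupoid\<close>

lemma openin_char_dom:
  assumes "e \<in> idems"
  shows "openin character_topology (char_dom e)"
proof -
  have "continuous_map character_topology (discrete_topology UNIV) (\<lambda>\<theta>. \<theta> e)"
    unfolding character_topology_def
    by (intro continuous_map_from_subtopology continuous_map_product_projection assms)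
  then have "openin character_topology {\<theta> \<in> topspace character_topology. \<theta> e \<in> {True}}"
    by (rule openin_continuous_map_preimage) simp
  then show ?thesis
    by (simp add: char_dom_def topspace_character_topology)
qed

lemma char_dom_mono:
  assumes "e \<in> idems" "f \<in> idems" "e * f = e"
  shows "char_dom e \<subseteq> char_dom f"
  using assms characters_mult[OF _ assms(1,2)] by (auto simp: char_dom_def)

lemma germ_pairs_iff: "(s, \<theta>) \<in> germ_pairs \<longleftrightarrow> \<theta> \<in> char_dom (star s * s)"
  by (simp add: germ_pairs_def)

lemma arrow_topology_universal:
  "arrow_topology (universal_groupoid S) = topology_generated_by
     {basic_bisection s U | s U. openin character_topology U \<and> U \<subseteq> char_dom (star s * s)}"
  by (simp add: universal_groupoid_def)

lemma openin_basic_bisection: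
  assumes "openin character_topology U" "U \<subseteq> char_dom (star s * s)"
  shows "openin (arrow_topology (universal_groupoid S)) (basic_bisection s U)"
  unfolding arrow_topology_universal using assms by (intro topology_generated_by_Basis) blast

lemma arrows_universal:
  "arrows (universal_groupoid S) = {germ s \<theta> | s \<theta>. (s, \<theta>) \<in> germ_pairs}"
proof -
  have "arrows (universal_groupoid S) =
      \<Union> {basic_bisection s U | s U. openin character_topology U \<and> U \<subseteq> char_dom (star s * s)}"
    by (simp add: arrow_topology_universal)
  also have "\<dots> = {germ s \<theta> | s \<theta>. (s, \<theta>) \<in> germ_pairs}" (is "?L = ?R")
  proof
    show "?L \<subseteq> ?R"
      by (auto simp: basic_bisection_def germ_pairs_iff)
    show "?R \<subseteq> ?L"
    proof clarify
      fix s :: 'a and \<theta>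
      assume "(s, \<theta>) \<in> germ_pairs"
      then have "germ s \<theta> \<in> basic_bisection s (char_dom (star s * s))"
        by (auto simp: basic_bisection_def germ_pairs_iff)
      then show "germ s \<theta> \<in> ?L"
        using openin_char_dom[OF star_mult_idems(1)[of s]] by blast
    qed
  qed
  finally show ?thesis .
qed

text \<open>The arrow topology is only given by generators, so continuity of \<open>germ s\<close>
  is proved by induction on their generation. For a generator from \<open>t\<close>, an idempotent
  \<open>e\<close> with \<open>s * e = t * e\<close> makes the germs of \<open>s\<close> and
  \<open>t\<close> agree on all of \<open>char_dom e\<close> within both domains.\<close>

lemma germ_neighbourhood:
  assumes "openin (arrow_topology (universal_groupoid S)) W"
    and "(s, \<theta>) \<in> germ_pairs" "germ s \<theta> \<in> W"
  obtains U where "openin character_topology U" "\<theta> \<in> U" "germ s ` U \<subseteq> W"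
proof -
  have "generate_topology_on
      {basic_bisection s U | s U. openin character_topology U \<and> U \<subseteq> char_dom (star s * s)} W"
    using assms(1) unfolding arrow_topology_universal openin_topology_generated_by_iff .
  then have "\<exists>U. openin character_topology U \<and> \<theta> \<in> U \<and> germ s ` U \<subseteq> W"
    using assms(3)
  proof (induction W rule: generate_topology_on.induct)
    case Empty
    then show ?case by simp
  next
    case (Int a b)
    then obtain U V where
      "openin character_topology U" "\<theta> \<in> U" "germ s ` U \<subseteq> a"
      "openin character_topology V" "\<theta> \<in> V" "germ s ` V \<subseteq> b" by auto
    then show ?case
      by (intro exI[of _ "U \<inter> V"]) (auto simp: openin_Int)
  next
    case (UN K)
    then obtain k where k: "k \<in> K" "germ s \<theta> \<in> k" by blast
    then obtain U where "openin character_topology U" "\<theta> \<in> U" "germ s ` U \<subseteq> k"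
      using UN.IH by metis
    moreover have "k \<subseteq> \<Union> K"
      using k by blast
    ultimately show ?case by (metis order_trans)
  next
    case (Basis b)
    then obtain t U where b: "b = basic_bisection t U" "openin character_topology U"
      "U \<subseteq> char_dom (star t * t)" by blast
    then obtain \<theta>' where \<theta>': "\<theta>' \<in> U" "germ s \<theta> = germ t \<theta>'"
      using Basis by (auto simp: basic_bisection_def)
    then have "((s, \<theta>), (t, \<theta>')) \<in> germ_rel"
      using assms(2) b by (subst germ_eq_iff[symmetric]) (auto simp: germ_pairs_iff)
    then obtain e where e: "\<theta>' = \<theta>" "e \<in> idems" "\<theta> e" "s * e = t * e"
      by (rule germ_relE)
    define V where "V = U \<inter> char_dom (star s * s) \<inter> char_dom e"
    have "germ s \<phi> = germ t \<phi>" if "\<phi> \<in> V" for \<phi>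
    proof -
      have p: "(s, \<phi>) \<in> germ_pairs" "(t, \<phi>) \<in> germ_pairs" "\<phi> e"
        using that b(3) by (auto simp: V_def germ_pairs_iff char_dom_def)
      then show ?thesis
        using e by (subst germ_eq_iff) (auto intro: germ_relI)
    qed
    then have "germ s ` V \<subseteq> b"
      by (auto simp: b(1) basic_bisection_def V_def)
    moreover have "openin character_topology V"
      unfolding V_def by (intro openin_Int b openin_char_dom e star_mult_idems)
    moreover have "\<theta> \<in> V"
      using assms(2) e \<theta>' by (auto simp: V_def germ_pairs_iff char_dom_def)
    ultimately show ?case by blast
  qed
  then show thesis using that by blast
qed

lemma germ_eqD:
  assumes "(s, \<theta>) \<in> germ_pairs" "(t, \<phi>) \<in> germ_pairs" "germ s \<theta> = germ t \<phi>"
  shows "\<theta> = \<phi>"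
  using assms by (metis src_germ)

section \<open>Restriction to the tight characters\<close>

lemma unit_topology_tight:
  "unit_topology (tight_groupoid S) = subtopology character_topology tight_characters"
  by (simp add: tight_groupoid_def restrict_groupoid_def universal_groupoid_def)

lemma tight_characters_subset: "tight_characters \<subseteq> characters"
  by (auto simp: tight_characters_def)

lemma units_tight: "units (tight_groupoid S) = tight_characters"
  using tight_characters_subset
  by (auto simp: unit_topology_tight topspace_character_topology)

lemma openin_arrows_tight:
  "openin (arrow_topology (tight_groupoid S)) T \<longleftrightarrow>
     (\<exists>W. openin (arrow_topology (universal_groupoid S)) W \<and> T = W \<inter> arrows (tight_groupoid S))"
proof -
  have "arrow_topology (tight_groupoid S) =
      subtopology (arrow_topology (universal_groupoid S)) (arrows (tight_groupoid S))"
    by (simp add: tight_groupoid_def restrict_groupoid_def subtopology_restrict)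
  then show ?thesis
    by (metis openin_subtopology)
qed

lemma arrows_tight:
  "arrows (tight_groupoid S) = {germ s \<theta> | s \<theta>.
     (s, \<theta>) \<in> germ_pairs \<and> \<theta> \<in> tight_characters \<and> char_act s \<theta> \<in> tight_characters}"
proof -
  have "arrows (tight_groupoid S) = {g \<in> arrows (universal_groupoid S).
      src (universal_groupoid S) g \<in> tight_characters \<and>
      tgt (universal_groupoid S) g \<in> tight_characters}"
    by (auto simp: tight_groupoid_def restrict_groupoid_def)
  then show ?thesis
    unfolding arrows_universal by (auto simp: src_germ tgt_germ) (auto simp: src_germ tgt_germ)
qed

lemma src_tight_germ: "(s, \<theta>) \<in> germ_pairs \<Longrightarrow> src (tight_groupoid S) (germ s \<theta>) = \<theta>"
  by (simp add: tight_groupoid_def restrict_groupoid_def src_germ)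

lemma tgt_tight_germ: "(s, \<theta>) \<in> germ_pairs \<Longrightarrow> tgt (tight_groupoid S) (germ s \<theta>) = char_act s \<theta>"
  by (simp add: tight_groupoid_def restrict_groupoid_def tgt_germ)

lemma unit_arrow_tight:
  assumes "\<theta> \<in> characters" "e \<in> idems" "\<theta> e"
  shows "unit_arrow (tight_groupoid S) \<theta> = germ e \<theta>"
  by (simp add: tight_groupoid_def restrict_groupoid_def unit_arrow_eq[OF assms])


section \<open>Idempotents and paths\<close>

lemma word_section_eq [simp]: "word_section g w = (\<lambda>i. g (i + length w))"
  by (induction w arbitrary: g) (auto simp: letter_section_def)

lemma seq_mult_one [simp]: "seq_mult (\<lambda>_. 1) g = g" "seq_mult g (\<lambda>_. 1) = g"
  by (simp_all add: seq_mult_def)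

lemma seq_mult_inv [simp]: "seq_mult (seq_inv g) g = (\<lambda>_. 1)"
  by (simp add: seq_mult_def seq_inv_def)

lemma word_act_one [simp]: "word_act (\<lambda>_. 1) w = w"
  by (auto simp: word_act_def intro!: nth_equalityI)

text \<open>In the notation of formal elements this is \<open>v v\<^sup>*\<close>, the partial
  identity on words with prefix \<open>v\<close>. Extending \<open>v\<close> gives a smaller
  idempotent.\<close>

definition cyl :: "'x list \<Rightarrow> 'x isg" where
  "cyl v = Elt v (\<lambda>_. 1) v"

text \<open>Equality of germs is equality after such a cut to a smaller domain, so this formula
  reduces germs to words and permutations.\<close>

lemma Elt_mult_cyl:
  "Elt u g v * cyl (v @ a) = Elt (u @ word_act g a) (\<lambda>i. g (i + length a)) (v @ a)"
  by (simp add: cyl_def times_isg_def)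

lemma cyl_mult_cyl: "cyl v * cyl (v @ a) = cyl (v @ a)"
  unfolding cyl_def[of v] Elt_mult_cyl by (simp add: cyl_def)

lemma star_Elt_mult: "star (Elt u g v) * Elt u g v = cyl v"
  by (simp add: star_isg_def times_isg_def cyl_def)

lemma cyl_idems [simp]: "cyl v \<in> idems"
  using cyl_mult_cyl[of v "[]"] by (simp add: idems_def)

lemma cyl_mult_cyl': "cyl (v @ a) * cyl v = cyl (v @ a)"
  using idems_commute[OF cyl_idems cyl_idems, of "v @ a" v] by (simp add: cyl_mult_cyl)

lemma cyl_mult_eq_0:
  assumes "\<nexists>a. w = v @ a" "\<nexists>a. v = w @ a"
  shows "cyl v * cyl w = 0"
  using assms by (auto simp: cyl_def times_isg_def zero_isg_def)

lemma cyl_neq_0 [simp]: "cyl v \<noteq> 0" "0 \<noteq> cyl v"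
  by (simp_all add: cyl_def zero_isg_def)

text \<open>A nonzero idempotent equals \<open>star e * e\<close>, which
  \<open>star_Elt_mult\<close> computes.\<close>

lemma idems_isg: "(idems :: 'x::finite isg set) = insert 0 (range cyl)"
proof
  show "idems \<subseteq> insert 0 (range (cyl :: 'x list \<Rightarrow> _))"
  proof
    fix e :: "'x isg"
    assume e: "e \<in> idems"
    show "e \<in> insert 0 (range cyl)"
    proof (cases e)
      case (Elt u g v)
      have "star (Elt u g v) * Elt u g v = Elt u g v"
        using star_idem[OF e] e unfolding Elt by (simp add: idems_def)
      then have "e = cyl v"
        unfolding Elt star_Elt_mult by simp
      then show ?thesis by simp
    qed (simp add: zero_isg_def)
  qed
next
  show "insert 0 (range cyl) \<subseteq> (idems :: 'x isg set)"
    by auto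
qed

section \<open>Characters given by infinite words\<close>

lemma stream_eqI:
  assumes "\<And>n. p !! n = q !! n"
  shows "p = q"
proof -
  have "smap id p = q"
    using assms by (simp add: smap_alt)
  then show ?thesis
    by (simp add: stream.map_id)
qed

lemma stake_prefix: "stake (length v) (v @- q) = v"
  by (simp add: stake_shift)

lemma shift_eq_stake: "p = v @- q \<Longrightarrow> length v \<le> n \<Longrightarrow> \<exists>a. stake n p = v @ a"
  by (auto simp: stake_shift)

definition path_char :: "'x::finite stream \<Rightarrow> 'x isg character" where
  "path_char p = (\<lambda>e\<in>idems. \<exists>v q. e = cyl v \<and> p = v @- q)"

lemma path_char_0 [simp]: "\<not> path_char p 0"
  by (simp add: path_char_def)

lemma cyl_inject [simp]: "cyl v = cyl w \<longleftrightarrow> v = w"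
  by (simp add: cyl_def)

lemma path_char_cyl: "path_char p (cyl v) \<longleftrightarrow> (\<exists>q. p = v @- q)"
  by (simp add: path_char_def)

lemma path_char_cyl_iff: "path_char p (cyl v) \<longleftrightarrow> stake (length v) p = v"
  unfolding path_char_cyl by (metis stake_prefix stake_sdrop)

lemma path_char_shift [simp]: "path_char (v @- q) (cyl v)"
  by (auto simp: path_char_cyl)

lemma path_char_stake [simp]: "path_char p (cyl (stake n p))"
  by (simp add: path_char_cyl_iff)

text \<open>Two prefixes of \<open>p\<close> are comparable. Hence incomparable words, whose
  cylinders have product \<open>0\<close>, are never both prefixes of \<open>p\<close>.\<close>

lemma path_char_characters [simp]: "path_char p \<in> characters"
proof -
  have m: "path_char p (cyl v * cyl w) \<longleftrightarrow> path_char p (cyl v) \<and> path_char p (cyl w)" for v w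
  proof (cases "(\<exists>a. w = v @ a) \<or> (\<exists>a. v = w @ a)")
    case True
    then show ?thesis
      by (auto simp: cyl_mult_cyl cyl_mult_cyl' path_char_cyl)
  next
    case False
    have "stake (length v) p = v \<Longrightarrow> stake (length w) p = w \<Longrightarrow> False"
      using False by (metis nat_le_linear stake_sdrop shift_eq_stake)
    then show ?thesis
      using False by (auto simp: cyl_mult_eq_0 path_char_cyl_iff)
  qed
  have "\<exists>e\<in>idems. path_char p e"
    by (rule bexI[of _ "cyl []"]) (simp_all add: path_char_cyl)
  moreover have "path_char p \<in> extensional idems"
    by (simp add: path_char_def)
  ultimately show ?thesis
    by (auto simp: characters_def idems_isg m)
qed

text \<open>For \<open>n\<close> at least \<open>length w\<close>, either \<open>stake n p\<close>
  extends \<open>w\<close> or the two are incomparable, so multiplying \<open>cyl w\<close> by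
  \<open>cyl (stake n p)\<close> decides \<open>\<theta> (cyl w)\<close>. The bound \<open>N\<close>
  admits images under \<open>Elt u g v\<close>, which are tested only on prefixes no shorter than
  \<open>u\<close>.\<close>

lemma character_eq_path_char:
  assumes "\<theta> \<in> characters" and *: "\<And>n. n \<ge> N \<Longrightarrow> \<theta> (cyl (stake n p))"
  shows "\<theta> = path_char p"
proof -
  have "\<theta> (cyl w) \<longleftrightarrow> path_char p (cyl w)" for w
  proof -
    define n where "n = max N (length w)"
    have n: "\<theta> (cyl w) \<longleftrightarrow> \<theta> (cyl w * cyl (stake n p))"
      using assms by (simp add: characters_mult n_def)
    show ?thesis
    proof (cases "\<exists>a. stake n p = w @ a")
      case True
      then obtain a where a: "stake n p = w @ a" ..
      then have "p = w @- a @- sdrop n p"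
        by (metis shift_append stake_sdrop)
      then have "path_char p (cyl w)"
        by (auto simp: path_char_cyl)
      moreover have "\<theta> (cyl w)"
        using n assms(2)[of n] by (simp add: a cyl_mult_cyl) (simp add: n_def)
      ultimately show ?thesis by simp
    next
      case False
      have "\<nexists>a. w = stake n p @ a"
      proof
        assume "\<exists>a. w = stake n p @ a"
        then obtain a where a: "w = stake n p @ a" ..
        have "length a = 0"
          using arg_cong[OF a, of length] by (simp add: n_def max_def split: if_splits)
        then show False using a False by auto
      qed
      then have "\<not> \<theta> (cyl w)"
        using n False assms(1) by (simp add: cyl_mult_eq_0 characters_def)
      moreover have "\<not> path_char p (cyl w)"
        using False shift_eq_stake[of p w _ n] by (auto simp: path_char_cyl n_def)
      ultimately show ?thesis by simp
    qed
  qed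
  then have "\<theta> e = path_char p e" if "e \<in> idems" for e
    using that assms(1) by (auto simp: idems_isg characters_def)
  moreover have "\<theta> \<in> extensional idems" "path_char p \<in> extensional idems"
    using assms(1) by (auto simp: characters_def path_char_def)
  ultimately show ?thesis
    by (intro extensionalityI[of \<theta> idems]) auto
qed

lemma path_char_inject: "path_char p = path_char q \<longleftrightarrow> p = q"
proof
  assume "path_char p = path_char q"
  then have "stake n p = stake n q" for n
    using path_char_stake[of p n] by (simp add: path_char_cyl_iff)
  then have "p !! n = q !! n" for n
    using stake_nth[of n "Suc n" p] stake_nth[of n "Suc n" q] by simp
  then show "p = q"
    by (rule stream_eqI)
qed simp

section \<open>Tight characters as infinite words\<close>

lemma natural_le_cyl: "natural_le (cyl (v @ a)) (cyl v)"
  unfolding natural_le_iff by (rule bexI[of _ "cyl (v @ a)"]) (simp_all add: cyl_mult_cyl)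

text \<open>A cover is finite, so some prefix of \<open>p\<close> is at least as long as all its
  words. A covering element that meets the cylinder of this prefix must belong to a prefix of
  \<open>p\<close>.\<close>

lemma tight_path_char: "path_char p \<in> tight_characters"
proof -
  have "\<exists>c\<in>C. path_char p c"
    if e: "e \<in> idems" and C: "covers C e" "path_char p e" for e C
  proof -
    obtain v q where v: "e = cyl v" "p = v @- q"
      using e C(2) by (auto simp: path_char_def)
    have "finite C" "C \<subseteq> idems"
      using C(1) by (auto simp: covers_def)
    define n where "n = Max (insert (length v) (length ` {w. cyl w \<in> C}))"
    have "finite {w. cyl w \<in> C}"
      using finite_vimageI[OF \<open>finite C\<close>, of cyl] by (simp add: inj_def vimage_def)
    then have n: "length v \<le> n" "\<And>w. cyl w \<in> C \<Longrightarrow> length w \<le> n"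
      by (auto simp: n_def)
    have "natural_le (cyl (stake n p)) e"
      using shift_eq_stake[OF v(2) n(1)] by (auto simp: v(1) natural_le_cyl)
    then obtain c where c: "c \<in> C" "cyl (stake n p) * c \<noteq> 0"
      using C(1) cyl_idems cyl_neq_0(1) unfolding covers_def by blast
    then obtain w where w: "c = cyl w"
      using \<open>C \<subseteq> idems\<close> by (auto simp: idems_isg)
    then consider a where "stake n p = w @ a" | a where "w = stake n p @ a"
      using c cyl_mult_eq_0 by blast
    then have "\<exists>a. stake n p = w @ a"
      using n(2)[of w] c(1) w by cases auto
    then have "path_char p (cyl w)"
      unfolding path_char_cyl by (metis shift_append stake_sdrop)
    then show ?thesis using c(1) w by blast
  qed
  then show ?thesis
    by (auto simp: tight_characters_def)
qed

text \<open>Finiteness of the alphabet makes this family finite, as a cover must be. It forces a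
  tight character that is true on a cylinder to select a next letter.\<close>

lemma covers_children:
  fixes v :: "'x::finite list"
  shows "covers (range (\<lambda>x. cyl (v @ [x]))) (cyl v)"
proof -
  have "\<exists>x. f * cyl (v @ [x]) \<noteq> 0" if f: "f \<in> idems" "f \<noteq> 0" "natural_le f (cyl v)" for f
  proof -
    obtain w where w: "f = cyl w"
      using f by (auto simp: idems_isg)
    obtain e where e: "f = cyl v * e"
      using f(3) by (auto simp: natural_le_iff)
    have fv: "cyl v * f = f"
      unfolding e mult.assoc[symmetric] using cyl_mult_cyl[of v "[]"] by simp
    then have "cyl v * cyl w \<noteq> 0"
      unfolding w by simp
    then consider a where "w = v @ a" | a where "v = w @ a"
      using cyl_mult_eq_0 by blast
    \<comment> \<open>Since \<open>f\<close> lies below \<open>cyl v\<close>, a word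
      \<open>w\<close> that is a prefix of \<open>v\<close> must equal \<open>v\<close>.\<close>
    then obtain a where a: "w = v @ a"
    proof cases
      case (2 a)
      then have "v = w"
        using fv w by (auto simp: cyl_mult_cyl')
      then show ?thesis using that[of "[]"] by simp
    qed
    \<comment> \<open>If \<open>w = v\<close>, any letter serves; otherwise the first letter of
      \<open>w\<close> after \<open>v\<close> does.\<close>
    show ?thesis
    proof (cases a)
      case Nil
      then have "f = cyl v" using a w by simp
      then show ?thesis by (simp add: cyl_mult_cyl)
    next
      case (Cons x b)
      then have "w = (v @ [x]) @ b" using a by simp
      then have "f * cyl (v @ [x]) = f" unfolding w by (simp only: cyl_mult_cyl')
      then have "f * cyl (v @ [x]) \<noteq> 0" using f(2) by simp
      then show ?thesis by blast
    qed
  qed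
  moreover have "range (\<lambda>x. cyl (v @ [x])) \<subseteq> {c \<in> idems. natural_le c (cyl v)}"
    using natural_le_cyl by auto
  ultimately show ?thesis
    unfolding covers_def by simp
qed

text \<open>Conversely to \<open>tight_path_char\<close>, repeated choice of a child cylinder on
  which a tight character is true spells out an infinite word, and its prefixes determine the
  character.\<close>

lemma tight_characters_isg: "tight_characters = range path_char"
proof
  show "tight_characters \<subseteq> range path_char"
  proof
    fix \<theta> :: "'x::finite isg character"
    assume tight: "\<theta> \<in> tight_characters"
    then have \<theta>: "\<theta> \<in> characters" by (simp add: tight_characters_def)
    \<comment> \<open>Every cylinder lies below \<open>cyl []\<close>, so a nonzero character is
      true there and the choice of letters can start.\<close>
    have Nil: "\<theta> (cyl [])"
    proof -
      obtain v where "\<theta> (cyl v)"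
        using \<theta> by (auto simp: characters_def idems_isg)
      then show ?thesis
        using \<theta> characters_mult[of \<theta> "cyl v" "cyl []"] cyl_mult_cyl'[of "[]" v] by simp
    qed
    have step: "\<exists>x. \<theta> (cyl (v @ [x]))" if v: "\<theta> (cyl v)" for v
    proof -
      have "\<exists>c\<in>range (\<lambda>x. cyl (v @ [x])). \<theta> c"
        using tight v covers_children[of v] cyl_idems[of v]
        unfolding tight_characters_def by blast
      then show ?thesis by blast
    qed
    define nxt where "nxt v = (SOME x. \<theta> (cyl (v @ [x])))" for v
    have nxt: "\<theta> (cyl (v @ [nxt v]))" if "\<theta> (cyl v)" for v
      unfolding nxt_def by (rule someI_ex[OF step[OF that]])
    define F where "F = rec_nat [] (\<lambda>n v. v @ [nxt v])"
    have F: "F 0 = []" "F (Suc n) = F n @ [nxt (F n)]" for n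
      by (simp_all add: F_def)
    have \<theta>F: "\<theta> (cyl (F n))" for n
      by (induction n) (simp_all only: F Nil nxt)
    define p where "p = smap (\<lambda>n. nxt (F n)) nats"
    have p: "p !! n = nxt (F n)" for n
      by (simp add: p_def)
    have "stake n p = F n" for n
    proof (induction n)
      case (Suc n)
      then show ?case by (simp only: stake_Suc F p)
    qed (simp add: F)
    then have "\<theta> = path_char p"
      using \<theta> \<theta>F by (intro character_eq_path_char[of _ 0]) simp_all
    then show "\<theta> \<in> range path_char" by simp
  qed
next
  show "range path_char \<subseteq> tight_characters"
    by (rule image_subsetI) (rule tight_path_char)
qed


section \<open>Germs at paths\<close>

definition stream_act :: "'x perm_seq \<Rightarrow> 'x stream \<Rightarrow> 'x stream" where
  "stream_act g p = smap (\<lambda>i. Perm.apply (g i) (p !! i)) nats"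

lemma snth_stream_act [simp]: "stream_act g p !! i = Perm.apply (g i) (p !! i)"
  by (simp add: stream_act_def)

lemma stream_act_shift:
  "stream_act g (w @- q) = word_act g w @- stream_act (\<lambda>i. g (i + length w)) q"
  by (rule stream_eqI) (auto simp: shift_snth word_act_def simp del: upt_Suc)

lemma stake_stream_act: "stake n (stream_act g q) = word_act g (stake n q)"
  by (rule nth_equalityI) (auto simp: word_act_def simp del: upt_Suc)

lemma germ_pairs_Elt: "(Elt u g v, \<theta>) \<in> germ_pairs \<longleftrightarrow> \<theta> \<in> char_dom (cyl v)"
  by (simp add: germ_pairs_iff star_Elt_mult)

lemma path_char_char_dom: "path_char p \<in> char_dom (cyl v) \<longleftrightarrow> (\<exists>q. p = v @- q)"
  by (simp add: char_dom_def path_char_cyl)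

lemma germ_pairs_path [simp]: "(Elt u g v, path_char (v @- q)) \<in> germ_pairs"
  by (simp add: germ_pairs_Elt char_dom_def)

text \<open>It suffices to test long prefixes of the target word. Such a prefix is
  \<open>u @ word_act g a\<close> with \<open>a\<close> a prefix of \<open>q\<close>, and its
  pullback contains the cylinder of \<open>v @ a\<close>.\<close>

lemma char_act_path:
  "char_act (Elt u g v) (path_char (v @- q)) = path_char (u @- stream_act g q)"
proof (rule character_eq_path_char[where N = "length u"])
  let ?s = "Elt u g v" and ?\<theta> = "path_char (v @- q)"
  have "?\<theta> \<in> char_dom (star ?s * ?s)"
    by (simp add: star_Elt_mult char_dom_def)
  from char_act_char_dom[OF this] show "char_act ?s ?\<theta> \<in> characters"
    by (simp add: char_dom_def)
  fix n
  assume n: "n \<ge> length u"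
  define a where "a = stake (n - length u) q"
  define e where "e = cyl (u @ word_act g a)"
  have "stake n (u @- stream_act g q) = u @ word_act g a"
    using n by (simp add: stake_shift stake_stream_act a_def)
  then have e: "cyl (stake n (u @- stream_act g q)) = e"
    by (simp add: e_def)
  have sf: "?s * cyl (v @ a) = Elt (u @ word_act g a) (\<lambda>i. g (i + length a)) (v @ a)"
    by (rule Elt_mult_cyl)
  \<comment> \<open>\<open>e\<close> is the range cylinder of \<open>?s * cyl (v @ a)\<close>, hence
    a left identity for it; so \<open>cyl (v @ a)\<close> lies below
    \<open>star ?s * e * ?s\<close>.\<close>
  have "e * (?s * cyl (v @ a)) = ?s * cyl (v @ a)"
    unfolding sf e_def by (simp add: cyl_def times_isg_def)
  then have "star ?s * e * ?s * cyl (v @ a) = star ?s * ?s * cyl (v @ a)"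
    by (simp add: mult.assoc)
  also have "\<dots> = cyl (v @ a)"
    unfolding star_Elt_mult by (rule cyl_mult_cyl)
  finally have prod: "star ?s * e * ?s * cyl (v @ a) = cyl (v @ a)" .
  have i: "e \<in> idems"
    by (simp add: e_def)
  have "v @- q = (v @ a) @- sdrop (n - length u) q"
    by (simp add: a_def stake_sdrop)
  then have "?\<theta> (cyl (v @ a))"
    by (metis path_char_shift)
  then have "?\<theta> (star ?s * e * ?s)"
    using characters_mult[OF path_char_characters conj_idems[OF i, of ?s] cyl_idems,
        of "v @- q" "v @ a"]
    unfolding prod by simp
  then show "char_act ?s ?\<theta> (cyl (stake n (u @- stream_act g q)))"
    using i unfolding e by (simp add: char_act_def)
qed

text \<open>The idempotent witnessing a germ equality can be shrunk to the cylinder of a longer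
  prefix of \<open>w @- q\<close>. On the cylinder of \<open>w @ stake n q\<close> the two products
  are compared component by component.\<close>

lemma germ_Elt_eq_iff:
  "germ (Elt A g w) (path_char (w @- q)) = germ (Elt B h w) (path_char (w @- q)) \<longleftrightarrow>
     (\<exists>n. A @ word_act g (stake n q) = B @ word_act h (stake n q) \<and> (\<forall>i\<ge>n. g i = h i))"
    (is "germ ?s ?\<theta> = germ ?t ?\<theta> \<longleftrightarrow> ?R")
proof -
  have tails: "(\<lambda>i. g (i + n)) = (\<lambda>i. h (i + n)) \<longleftrightarrow> (\<forall>i\<ge>n. g i = h i)" for n
    by (auto simp: fun_eq_iff) (metis le_add_diff_inverse2)
  have mult: "?s * cyl (w @ stake n q) = ?t * cyl (w @ stake n q) \<longleftrightarrow>
      A @ word_act g (stake n q) = B @ word_act h (stake n q) \<and> (\<forall>i\<ge>n. g i = h i)" for n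
    unfolding Elt_mult_cyl by (simp add: tails)
  have "germ ?s ?\<theta> = germ ?t ?\<theta> \<longleftrightarrow> (\<exists>n. ?s * cyl (w @ stake n q) = ?t * cyl (w @ stake n q))"
  proof
    assume "germ ?s ?\<theta> = germ ?t ?\<theta>"
    then have "((?s, ?\<theta>), (?t, ?\<theta>)) \<in> germ_rel"
      by (simp add: germ_eq_iff)
    then obtain e where e: "e \<in> idems" "?\<theta> e" "?s * e = ?t * e"
      by (rule germ_relE)
    then obtain v r where v: "e = cyl v" "w @- q = v @- r"
      by (auto simp: path_char_def)
    \<comment> \<open>A prefix this long extends both \<open>w\<close> and \<open>v\<close>, so the
      equation passes from \<open>cyl v\<close> to a cylinder of the required form.\<close>
    have "stake (length w + length v) (w @- q) = w @ stake (length v) q"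
      by (simp add: stake_shift)
    then obtain a where a: "w @ stake (length v) q = v @ a"
      using shift_eq_stake[OF v(2), of "length w + length v"] by auto
    have "?s * (e * cyl (w @ stake (length v) q)) = ?t * (e * cyl (w @ stake (length v) q))"
      using e(3) by (simp flip: mult.assoc)
    then show "\<exists>n. ?s * cyl (w @ stake n q) = ?t * cyl (w @ stake n q)"
      unfolding v(1) a cyl_mult_cyl unfolding a[symmetric] by blast
  next
    assume "\<exists>n. ?s * cyl (w @ stake n q) = ?t * cyl (w @ stake n q)"
    then obtain n where n: "?s * cyl (w @ stake n q) = ?t * cyl (w @ stake n q)" ..
    have "w @- q = (w @ stake n q) @- sdrop n q"
      by (simp add: stake_sdrop)
    then have "?\<theta> (cyl (w @ stake n q))"
      by (metis path_char_shift)
    then show "germ ?s ?\<theta> = germ ?t ?\<theta>"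
      using germ_relI[OF germ_pairs_path germ_pairs_path cyl_idems _ n] by (simp add: germ_eq_iff)
  qed
  then show ?thesis
    unfolding mult .
qed

text \<open>Cutting an element by a cylinder that contains the path does not change its germ. This
  lets the last component be lengthened.\<close>

lemma germ_Elt_restrict:
  "germ (Elt u g v) (path_char (v @- a @- q)) =
     germ (Elt (u @ word_act g a) (\<lambda>i. g (i + length a)) (v @ a)) (path_char (v @- a @- q))"
proof -
  let ?s = "Elt u g v" and ?t = "Elt u g v * cyl (v @ a)" and ?\<theta> = "path_char (v @- a @- q)"
  have t: "?t = Elt (u @ word_act g a) (\<lambda>i. g (i + length a)) (v @ a)"
    by (rule Elt_mult_cyl)
  have p: "(?t, ?\<theta>) \<in> germ_pairs"
    using germ_pairs_path[of _ _ "v @ a" q] unfolding t by simp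
  have "?s * cyl (v @ a) = ?t * cyl (v @ a)"
    using cyl_idems[of "v @ a"] by (simp add: idems_def mult.assoc)
  then have "((?s, ?\<theta>), (?t, ?\<theta>)) \<in> germ_rel"
    using path_char_shift[of "v @ a" q] by (intro germ_relI[OF _ p, of _ "cyl (v @ a)"]) auto
  then have "germ ?s ?\<theta> = germ ?t ?\<theta>"
    using p by (simp add: germ_eq_iff)
  then show ?thesis
    unfolding t .
qed

section \<open>Arrows and open sets of the tight groupoid\<close>

lemma germ_Elt_arrow [simp]:
  "germ (Elt u g v) (path_char (v @- q)) \<in> arrows (tight_groupoid TYPE('x::finite isg))"
proof -
  have "char_act (Elt u g v) (path_char (v @- q)) \<in> tight_characters"
    unfolding char_act_path by (rule tight_path_char)
  then show ?thesis
    unfolding arrows_tight using germ_pairs_path tight_path_char by blast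
qed

lemma tight_arrow_cases:
  fixes a :: "'x::finite isg germ_class"
  assumes "a \<in> arrows (tight_groupoid TYPE('x isg))"
  obtains u g v q where "a = germ (Elt u g v) (path_char (v @- q))"
proof -
  obtain s \<theta> where s: "a = germ s \<theta>" "(s, \<theta>) \<in> germ_pairs" "\<theta> \<in> tight_characters"
    using assms unfolding arrows_tight by blast
  obtain p where p: "\<theta> = path_char p"
    using s(3) unfolding tight_characters_isg by blast
  have "s \<noteq> 0"
    using s(2) by (auto simp: p germ_pairs_iff char_dom_def)
  then obtain u g v where "s = Elt u g v"
    by (cases s) (auto simp: zero_isg_def)
  with s(1,2) show thesis
    using that by (auto simp: p germ_pairs_Elt path_char_char_dom)
qed

text \<open>Two arrows can thus be written with last components of the same length, which are equal
  when the sources coincide.\<close>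

lemma tight_arrow_normal_form:
  fixes a :: "'x::finite isg germ_class"
  assumes "a \<in> arrows (tight_groupoid TYPE('x isg))"
  obtains p N where "\<And>n. n \<ge> N \<Longrightarrow> \<exists>A g. a = germ (Elt A g (stake n p)) (path_char p)"
proof -
  obtain u g v q where a: "a = germ (Elt u g v) (path_char (v @- q))"
    using assms by (rule tight_arrow_cases)
  have "\<exists>A h. a = germ (Elt A h (stake n (v @- q))) (path_char (v @- q))"
    if "n \<ge> length v" for n
  proof -
    let ?b = "stake (n - length v) q"
    have "stake n (v @- q) = v @ ?b"
      using that by (simp add: stake_shift)
    moreover have "a = germ (Elt (u @ word_act g ?b) (\<lambda>i. g (i + length ?b)) (v @ ?b))
        (path_char (v @- q))"
      using germ_Elt_restrict[of u g v ?b "sdrop (n - length v) q"] unfolding a stake_sdrop .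
    ultimately show ?thesis by metis
  qed
  then show thesis by (rule that)
qed

text \<open>These sets are the basic bisections over \<open>cyl (w @ u)\<close> cut down to tight
  arrows. The word \<open>u\<close> shrinks a neighbourhood without changing the representing
  element.\<close>

lemma openin_germ_cylinder:
  "openin (arrow_topology (tight_groupoid TYPE('x::finite isg)))
     (range (\<lambda>q. germ (Elt A g w) (path_char (w @- u @- q))))" (is "openin _ ?Z")
proof -
  let ?B = "basic_bisection (Elt A g w) (char_dom (cyl (w @ u)))"
  have "openin (arrow_topology (universal_groupoid TYPE('x isg))) ?B"
    unfolding star_Elt_mult
    by (intro openin_basic_bisection openin_char_dom cyl_idems)
       (simp add: star_Elt_mult char_dom_mono cyl_mult_cyl')
  moreover have "?Z = ?B \<inter> arrows (tight_groupoid TYPE('x isg))"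
  proof
    show "?Z \<subseteq> ?B \<inter> arrows (tight_groupoid TYPE('x isg))"
    proof (rule image_subsetI, rule IntI)
      fix q
      have "path_char (w @- u @- q) \<in> char_dom (cyl (w @ u))"
        unfolding path_char_char_dom by (rule exI[of _ q]) simp
      then show "germ (Elt A g w) (path_char (w @- u @- q)) \<in> ?B"
        unfolding basic_bisection_def by (rule imageI)
    qed (rule germ_Elt_arrow)
    show "?B \<inter> arrows (tight_groupoid TYPE('x isg)) \<subseteq> ?Z"
    proof
      fix a
      assume a: "a \<in> ?B \<inter> arrows (tight_groupoid TYPE('x isg))"
      then obtain \<theta> where \<theta>: "a = germ (Elt A g w) \<theta>" "\<theta> \<in> char_dom (cyl (w @ u))"
        by (auto simp: basic_bisection_def)
      have "(Elt A g w, \<theta>) \<in> germ_pairs"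
        using \<theta>(2) char_dom_mono[of "cyl (w @ u)" "cyl w"] by (auto simp: germ_pairs_Elt cyl_mult_cyl')
      \<comment> \<open>The bisection also has germs at characters that are not tight. A tight arrow
        has a path as its source, which identifies \<open>\<theta>\<close>.\<close>
      moreover obtain B h v r where "a = germ (Elt B h v) (path_char (v @- r))"
        using a by (blast elim: tight_arrow_cases)
      ultimately have "\<theta> = path_char (v @- r)"
        using \<theta>(1) germ_pairs_path by (metis germ_eqD)
      then obtain q where "\<theta> = path_char (w @- u @- q)"
        using \<theta>(2) by (auto simp: path_char_char_dom)
      then show "a \<in> ?Z"
        using \<theta>(1) by blast
    qed
  qed
  ultimately show ?thesis
    unfolding openin_arrows_tight by blast
qed

text \<open>A basic open set of the product topology restricts finitely many coordinates, and
  \<open>n\<close> bounds the words of those that are cylinders. At \<open>0\<close> all path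
  characters agree.\<close>

lemma path_char_neighbourhood:
  assumes "openin character_topology U" "path_char p \<in> U"
  obtains n where "\<And>q. stake n q = stake n p \<Longrightarrow> path_char q \<in> U"
proof -
  obtain V where V: "openin (product_topology (\<lambda>_. discrete_topology UNIV) idems) V"
    "U = V \<inter> characters"
    using assms(1) by (auto simp: character_topology_def openin_subtopology)
  then obtain W where W: "finite {e \<in> idems. W e \<noteq> UNIV}" "path_char p \<in> Pi\<^sub>E idems W"
    "Pi\<^sub>E idems W \<subseteq> V"
    using assms(2) unfolding openin_product_topology_alt by force
  let ?F = "{v. W (cyl v) \<noteq> UNIV}"
  have "finite ?F"
    using finite_vimageI[OF W(1), of cyl] by (simp add: inj_def vimage_def)
  define n where "n = Max (insert 0 (length ` ?F))"
  have n: "length v \<le> n" if "v \<in> ?F" for v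
    using that \<open>finite ?F\<close> by (simp add: n_def)
  have "path_char q \<in> U" if q: "stake n q = stake n p" for q
  proof -
    have *: "path_char q (cyl v) = path_char p (cyl v)" if "v \<in> ?F" for v
    proof -
      have "stake (length v) q = stake (length v) p"
        using arg_cong[OF q, of "take (length v)"] n[OF that] by (simp add: take_stake)
      then show ?thesis by (simp add: path_char_cyl_iff)
    qed
    have "path_char q e \<in> W e" if "e \<in> idems" for e
    proof (cases "W e = UNIV")
      case False
      then have "path_char q e = path_char p e"
        using that * by (auto simp: idems_isg)
      moreover have "path_char p e \<in> W e"
        using W(2) that by (rule PiE_mem)
      ultimately show ?thesis by simp
    qed simp
    then have "path_char q \<in> Pi\<^sub>E idems W"
      by (simp add: PiE_def path_char_def)
    then show ?thesis
      using W(3) V(2) by auto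
  qed
  then show thesis by (rule that)
qed


section \<open>The four properties\<close>

text \<open>Whether two germs at \<open>w q\<close> agree is decided by a prefix of \<open>q\<close> of bounded length: if the
  two sequences of permutations agree from some index \<open>N\<close> on, then only the first \<open>N\<close> letters of
  \<open>q\<close> matter, and otherwise the germs never agree.\<close>

lemma germ_Elt_separated:
  assumes "germ (Elt A g w) (path_char (w @- q)) \<noteq> germ (Elt B h w) (path_char (w @- q))"
  obtains N where "\<And>r. stake N r = stake N q \<Longrightarrow>
    germ (Elt A g w) (path_char (w @- r)) \<noteq> germ (Elt B h w) (path_char (w @- r))"
proof (cases "\<exists>N. \<forall>i\<ge>N. g i = h i")
  case True
  then obtain N where N: "\<And>i. i \<ge> N \<Longrightarrow> g i = h i" by blast
  have tail: "(\<lambda>i. g (i + N)) = (\<lambda>i. h (i + N))"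
    using N by auto
  have "germ (Elt A g w) (path_char (w @- r)) \<noteq> germ (Elt B h w) (path_char (w @- r))"
    if r: "stake N r = stake N q" for r
  proof
    assume "germ (Elt A g w) (path_char (w @- r)) = germ (Elt B h w) (path_char (w @- r))"
    then obtain n where n: "A @ word_act g (stake n r) = B @ word_act h (stake n r)"
      "\<And>i. i \<ge> n \<Longrightarrow> g i = h i"
      unfolding germ_Elt_eq_iff by blast
    have "A @ word_act g (stake N r) = B @ word_act h (stake N r)"
    \<comment> \<open>Lengthening the prefix from \<open>n\<close> to \<open>N\<close> appends the
      same letters on both sides, as \<open>g\<close> and \<open>h\<close> agree from
      \<open>n\<close> on. Shortening it from \<open>n\<close> to \<open>N\<close> cancels equal
      suffixes, as they agree from \<open>N\<close> on.\<close>
    proof (cases "n \<le> N")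
      case True
      then obtain k where k: "N = n + k"
        by (auto simp: le_iff_add)
      have "(\<lambda>i. g (i + n)) = (\<lambda>i. h (i + n))"
        using n(2) by auto
      then show ?thesis
        using n(1) unfolding k stake_add[symmetric] by (simp add: word_act_append del: stake_add)
    next
      case False
      then obtain k where k: "n = N + k"
        by (metis le_iff_add nat_le_linear)
      show ?thesis
        using n(1) tail unfolding k stake_add[symmetric]
        by (simp add: word_act_append del: stake_add append_assoc flip: append_assoc)
    qed
    then have "germ (Elt A g w) (path_char (w @- q)) = germ (Elt B h w) (path_char (w @- q))"
      unfolding germ_Elt_eq_iff r using N by blast
    with assms show False by contradiction
  qed
  then show thesis by (rule that)
next
  case False
  then show thesis
    using that[of 0] unfolding germ_Elt_eq_iff by blast
qed

text \<open>Different sources are separated by prefixes reaching past an index where they differ.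
  For equal sources, \<open>germ_Elt_separated\<close> gives a cylinder over which the two germs
  differ everywhere.\<close>

lemma hausdorff_tight: "hausdorff_groupoid (tight_groupoid TYPE('x::finite isg))"
  unfolding hausdorff_groupoid_def Hausdorff_space_def
proof (intro allI impI, elim conjE)
  fix a b :: "'x isg germ_class"
  assume ab: "a \<in> arrows (tight_groupoid TYPE('x isg))" "b \<in> arrows (tight_groupoid TYPE('x isg))"
    and "a \<noteq> b"
  obtain p N where p: "\<And>n. n \<ge> N \<Longrightarrow> \<exists>A g. a = germ (Elt A g (stake n p)) (path_char p)"
    by (rule tight_arrow_normal_form[OF ab(1)]) blast
  obtain p' N' where p': "\<And>n. n \<ge> N' \<Longrightarrow> \<exists>A g. b = germ (Elt A g (stake n p')) (path_char p')"
    by (rule tight_arrow_normal_form[OF ab(2)]) blast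
  obtain k where k: "p = p' \<or> p !! k \<noteq> p' !! k"
    using stream_eqI by blast
  obtain n where n: "N \<le> n" "N' \<le> n" "k < n"
    using that[of "N + N' + Suc k"] by simp
  define w w' q q' where "w = stake n p" and "w' = stake n p'"
    and "q = sdrop n p" and "q' = sdrop n p'"
  have pw: "p = w @- q" "p' = w' @- q'"
    by (simp_all add: w_def w'_def q_def q'_def stake_sdrop)
  obtain A g where a: "a = germ (Elt A g w) (path_char (w @- q))"
    using p[OF n(1)] unfolding w_def q_def stake_sdrop by blast
  obtain B h where b: "b = germ (Elt B h w') (path_char (w' @- q'))"
    using p'[OF n(2)] unfolding w'_def q'_def stake_sdrop by blast
  let ?Z = "\<lambda>A g w u. range (\<lambda>q. germ (Elt A g w) (path_char (w @- u @- q)))"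
  have "\<exists>u u'. a \<in> ?Z A g w u \<and> b \<in> ?Z B h w' u' \<and> disjnt (?Z A g w u) (?Z B h w' u')"
  proof (cases "p = p'")
    case True
    then have w: "w' = w" "q' = q"
      by (simp_all add: w_def w'_def q_def q'_def)
    obtain M where M: "\<And>r. stake M r = stake M q \<Longrightarrow>
        germ (Elt A g w) (path_char (w @- r)) \<noteq> germ (Elt B h w) (path_char (w @- r))"
      using \<open>a \<noteq> b\<close> unfolding a b w by (rule germ_Elt_separated) blast
    have "disjnt (?Z A g w (stake M q)) (?Z B h w (stake M q))"
    proof -
      \<comment> \<open>Equal germs have equal sources, so only germs at the same path need
        comparison.\<close>
      have False if eq: "germ (Elt A g w) (path_char (w @- stake M q @- r)) =
          germ (Elt B h w) (path_char (w @- stake M q @- r'))" for r r'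
      proof -
        have "path_char (w @- stake M q @- r) = path_char (w @- stake M q @- r')"
          by (rule germ_eqD[OF germ_pairs_path germ_pairs_path eq])
        then have "r = r'"
          by (simp add: path_char_inject)
        then show False
          using eq M[of "stake M q @- r"] by (simp add: stake_shift)
      qed
      then show ?thesis
        unfolding disjnt_iff by blast
    qed
    moreover have "a \<in> ?Z A g w (stake M q)" "b \<in> ?Z B h w (stake M q)"
      unfolding a b w by (rule range_eqI[of _ _ "sdrop M q"], simp only: stake_sdrop)+
    ultimately show ?thesis
      unfolding w by blast
  next
    case False
    have "w \<noteq> w'"
    proof
      assume "w = w'"
      then have "w ! k = w' ! k" by simp
      then show False
        using False k n(3) by (simp add: w_def w'_def)
    qed
    have False if eq: "germ (Elt A g w) (path_char (w @- [] @- r)) =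
        germ (Elt B h w') (path_char (w' @- [] @- r'))" for r r'
    proof -
      have "path_char (w @- r) = path_char (w' @- r')"
        using germ_eqD[OF germ_pairs_path germ_pairs_path] eq by simp
      then have "stake n (w @- r) = stake n (w' @- r')"
        by (simp add: path_char_inject)
      then show False
        using \<open>w \<noteq> w'\<close> by (simp add: stake_shift w_def w'_def)
    qed
    then have "disjnt (?Z A g w []) (?Z B h w' [])"
      unfolding disjnt_iff by blast
    moreover have "a \<in> ?Z A g w []" "b \<in> ?Z B h w' []"
      unfolding a b by simp_all
    ultimately show ?thesis by blast
  qed
  then show "\<exists>U V. openin (arrow_topology (tight_groupoid TYPE('x isg))) U \<and>
      openin (arrow_topology (tight_groupoid TYPE('x isg))) V \<and> a \<in> U \<and> b \<in> V \<and> disjnt U V"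
    using openin_germ_cylinder by metis
qed

text \<open>Prepending any \<open>u\<close> to \<open>p\<close> stays in its orbit, by the germ of
  \<open>Elt u (\<lambda>_. 1) []\<close>. Taking a long prefix of \<open>r\<close> for
  \<open>u\<close> comes arbitrarily close to \<open>path_char r\<close>.\<close>

lemma minimal_tight: "minimal_groupoid (tight_groupoid TYPE('x::finite isg))"
  unfolding minimal_groupoid_def
proof
  let ?G = "tight_groupoid TYPE('x isg)"
  fix \<theta>
  assume "\<theta> \<in> units ?G"
  then obtain p where p: "\<theta> = path_char p"
    by (auto simp: units_tight tight_characters_isg)
  have orbit: "path_char (u @- p) \<in> groupoid_orbit ?G \<theta>" for u
  proof -
    let ?s = "Elt u (\<lambda>_. 1) []"
    have g: "(?s, path_char p) \<in> germ_pairs" "germ ?s (path_char p) \<in> arrows ?G"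
      using germ_pairs_path[of _ _ "[]" p] germ_Elt_arrow[of u "\<lambda>_. 1" "[]" p] by simp_all
    have "stream_act (\<lambda>_. 1) p = p"
      by (rule stream_eqI) simp
    then have "char_act ?s (path_char p) = path_char (u @- p)"
      using char_act_path[of u "\<lambda>_. 1" "[]" p] by simp
    then have "tgt ?G (germ ?s (path_char p)) = path_char (u @- p)"
      using g(1) by (simp add: tgt_tight_germ)
    moreover have "src ?G (germ ?s (path_char p)) = \<theta>"
      using g(1) by (simp add: src_tight_germ p)
    ultimately show ?thesis
      using g(2) unfolding groupoid_orbit_def by (metis (mono_tags, lifting) mem_Collect_eq)
  qed
  have "\<phi> \<in> unit_topology ?G closure_of groupoid_orbit ?G \<theta>" if \<phi>: "\<phi> \<in> units ?G" for \<phi>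
    unfolding in_closure_of
  proof (intro conjI allI impI)
    fix T
    assume T: "\<phi> \<in> T \<and> openin (unit_topology ?G) T"
    then obtain U where U: "openin character_topology U" "T = U \<inter> tight_characters"
      by (auto simp: unit_topology_tight openin_subtopology)
    obtain r where r: "\<phi> = path_char r"
      using \<phi> by (auto simp: units_tight tight_characters_isg)
    then have "path_char r \<in> U"
      using T U by simp
    with U(1) obtain n where "\<And>q. stake n q = stake n r \<Longrightarrow> path_char q \<in> U"
      by (rule path_char_neighbourhood) blast
    then have "path_char (stake n r @- p) \<in> T"
      by (simp add: U(2) tight_path_char stake_shift)
    then show "\<exists>y. y \<in> groupoid_orbit ?G \<theta> \<and> y \<in> T"
      using orbit by blast
  qed (rule \<phi>)
  then show "unit_topology ?G closure_of groupoid_orbit ?G \<theta> = units ?G"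
    by (intro subset_antisym closure_of_subset_topspace subsetI)
qed

text \<open>Constant words exclude different lengths: at the position just after the shorter of
  \<open>A\<close> and \<open>w\<close>, one side varies with the letter while the other is a fixed
  letter.\<close>

lemma stream_act_eq_shift:
  fixes x y :: 'x and A w :: "'x list"
  assumes "x \<noteq> y" and eq: "\<And>q. A @- stream_act g q = w @- q"
  shows "A = w" "g = (\<lambda>_. 1)"
proof -
  have nth: "(A @- stream_act g q) !! n = (w @- q) !! n" for q n
    by (simp add: eq)
  have "\<not> length A < length w"
  proof
    assume "length A < length w"
    then have "Perm.apply (g 0) z = w ! length A" for z
      using nth[of "sconst z" "length A"] by (simp add: shift_snth del: snth.simps(1))
    then have "Perm.apply (g 0) x = Perm.apply (g 0) y" by simp
    then show False using \<open>x \<noteq> y\<close> by (simp add: apply_inj)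
  qed
  moreover have "\<not> length w < length A"
  proof
    assume "length w < length A"
    then have "A ! length w = z" for z
      using nth[of "sconst z" "length w"] by (simp add: shift_snth del: snth.simps(1))
    then show False using \<open>x \<noteq> y\<close> by metis
  qed
  ultimately have len: "length A = length w" by simp
  show "A = w"
    using arg_cong[OF eq, of "stake (length w)" undefined] len by (simp add: stake_shift)
  then have fix_q: "stream_act g q = q" for q
    using eq[of q] by simp
  show "g = (\<lambda>_. 1)"
  proof
    fix i
    show "g i = 1"
      using arg_cong[OF fix_q, of "\<lambda>s. s !! i" "sconst z" for z]
      by (intro perm_eqI) simp
  qed
qed

text \<open>A neighbourhood inside the isotropy contains the germs of one element at all paths
  \<open>w @- u @- r\<close>. That element fixes all of them, so by
  \<open>stream_act_eq_shift\<close> it restricts to the idempotent \<open>cyl (w @ u)\<close>,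
  whose germ is a unit.\<close>

lemma effective_tight:
  assumes "CARD('x::finite) \<ge> 2"
  shows "effective_groupoid (tight_groupoid TYPE('x isg))"
proof -
  let ?G = "tight_groupoid TYPE('x isg)"
  let ?I = "{a \<in> arrows ?G. src ?G a = tgt ?G a}"
  have unit: "unit_arrow ?G (path_char p) = germ (cyl v) (path_char p)" if "p = v @- q" for p q v
    using that by (intro unit_arrow_tight) auto
  \<comment> \<open>The empty words bring the units into the form of
    \<open>openin_germ_cylinder\<close>, which shows that they are open.\<close>
  have units: "unit_arrow ?G ` units ?G =
      range (\<lambda>q. germ (Elt [] (\<lambda>_. 1) []) (path_char ([] @- [] @- q)))"
    unfolding units_tight tight_characters_isg image_image
    using unit[of _ "[]"] by (simp add: cyl_def)
  have "unit_arrow ?G ` units ?G \<subseteq> ?I"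
  proof -
    have "germ (Elt [] (\<lambda>_. 1) []) (path_char q) \<in> ?I" for q
    proof -
      have "stream_act (\<lambda>_. 1) q = q"
        by (rule stream_eqI) simp
      then have "char_act (Elt [] (\<lambda>_. 1) []) (path_char q) = path_char q"
        using char_act_path[of "[]" "\<lambda>_. 1" "[]" q] by simp
      then show ?thesis
        using germ_pairs_path[of _ _ "[]" q] germ_Elt_arrow[of "[]" "\<lambda>_. 1" "[]" q]
        by (simp add: src_tight_germ tgt_tight_germ)
    qed
    then show ?thesis
      unfolding units by auto
  qed
  moreover have "openin (arrow_topology ?G) (unit_arrow ?G ` units ?G)"
    unfolding units by (rule openin_germ_cylinder)
  ultimately have "unit_arrow ?G ` units ?G \<subseteq> arrow_topology ?G interior_of ?I"
    by (rule interior_of_maximal)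
  moreover have "arrow_topology ?G interior_of ?I \<subseteq> unit_arrow ?G ` units ?G"
  proof
    fix a
    assume "a \<in> arrow_topology ?G interior_of ?I"
    then obtain T where T: "openin (arrow_topology ?G) T" "a \<in> T" "T \<subseteq> ?I"
      by (auto simp: interior_of_def)
    then have "a \<in> arrows ?G"
      by blast
    then obtain A g w q where a: "a = germ (Elt A g w) (path_char (w @- q))"
      by (rule tight_arrow_cases)
    obtain T' where T': "openin (arrow_topology (universal_groupoid TYPE('x isg))) T'"
      "T = T' \<inter> arrows ?G"
      using T(1) unfolding openin_arrows_tight by blast
    have "germ (Elt A g w) (path_char (w @- q)) \<in> T'"
      using T(2) T'(2) a by blast
    with T'(1) germ_pairs_path obtain U where U: "openin character_topology U"
      "path_char (w @- q) \<in> U" "germ (Elt A g w) ` U \<subseteq> T'"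
      by (rule germ_neighbourhood)
    obtain n where n: "\<And>r. stake n r = stake n (w @- q) \<Longrightarrow> path_char r \<in> U"
      using U(1,2) by (rule path_char_neighbourhood) blast
    define u where "u = stake n q"
    have q: "q = u @- sdrop n q"
      by (simp add: u_def stake_sdrop)
    have "(A @ word_act g u) @- stream_act (\<lambda>i. g (i + length u)) r = (w @ u) @- r" for r
    proof -
      have "stake n (w @- u @- r) = stake n (w @- q)"
        by (simp add: stake_shift u_def take_stake)
      then have "germ (Elt A g w) (path_char (w @- u @- r)) \<in> T"
        using n U(3) T'(2) by auto
      then have "path_char (w @- u @- r) = char_act (Elt A g w) (path_char (w @- u @- r))"
        using T(3) by (auto simp: src_tight_germ tgt_tight_germ)
      then show ?thesis
        by (simp add: char_act_path path_char_inject stream_act_shift)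
    qed
    moreover obtain x y :: 'x where "x \<noteq> y"
    proof -
      have "\<not> card (UNIV :: 'x set) \<le> Suc 0"
        using assms by simp
      then show thesis
        using that card_le_Suc0_iff_eq[of "UNIV :: 'x set"] by auto
    qed
    ultimately have Ag: "A @ word_act g u = w @ u" "(\<lambda>i. g (i + length u)) = (\<lambda>_. 1)"
      using stream_act_eq_shift by metis+
    have "a = germ (Elt (A @ word_act g u) (\<lambda>i. g (i + length u)) (w @ u)) (path_char (w @- q))"
      unfolding a by (subst (1 2) q) (rule germ_Elt_restrict)
    also have "\<dots> = germ (cyl (w @ u)) (path_char (w @- q))"
      unfolding Ag cyl_def ..
    also have "\<dots> = unit_arrow ?G (path_char (w @- q))"
      using unit[of "w @- q" "w @ u" "sdrop n q"] q by simp
    finally show "a \<in> unit_arrow ?G ` units ?G"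
      by (auto simp: units_tight tight_path_char)
  qed
  ultimately show ?thesis
    unfolding effective_groupoid_def by (rule subset_antisym[rotated])
qed

section \<open>Uncountable isotropy groups\<close>

lemma uncountable_nat_sets: "uncountable (UNIV :: nat set set)"
proof
  assume "countable (UNIV :: nat set set)"
  then have "range (from_nat_into (UNIV :: nat set set)) = Pow UNIV"
    by (simp add: range_from_nat_into)
  then show False
    using Cantors_theorem by blast
qed

text \<open>The transposition of two letters other than \<open>x\<close> serves; this is where the
  third letter enters.\<close>

lemma nontrivial_stabilizer:
  assumes "CARD('x::finite) \<ge> 3"
  shows "\<exists>t. Perm.apply t (x::'x) = x \<and> t \<noteq> 1"
proof -
  have "\<not> card (UNIV - {x}) \<le> Suc 0"
    using assms by (simp add: card_Diff_singleton)
  then obtain y z where "y \<noteq> x" "z \<noteq> x" "y \<noteq> z"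
    using card_le_Suc0_iff_eq[of "UNIV - {x}"] by auto
  then have "Perm.apply (Perm.swap y z) x = x" "Perm.swap y z \<noteq> 1"
    by (auto simp: apply_swap_eq_iff) (metis apply_one apply_swap_simp(1) id_apply)
  then show ?thesis by blast
qed

text \<open>Each natural number is the first component of infinitely many pair codes, so distinct sets
  \<open>A\<close> give sequences \<open>g A\<close> that differ at infinitely many places and hence distinct germs.\<close>

lemma uncountable_isotropy_tight:
  assumes "CARD('x::finite) \<ge> 3" "\<theta> \<in> units (tight_groupoid TYPE('x isg))"
  shows "uncountable (isotropy (tight_groupoid TYPE('x isg)) \<theta>)"
proof -
  let ?G = "tight_groupoid TYPE('x isg)"
  obtain p where p: "\<theta> = path_char p"
    using assms(2) by (auto simp: units_tight tight_characters_isg)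
  obtain t :: "'x \<Rightarrow> 'x perm" where t: "\<And>x. Perm.apply (t x) x = x" "\<And>x. t x \<noteq> 1"
    using nontrivial_stabilizer[OF assms(1)] by metis
  \<comment> \<open>Coordinate \<open>i\<close> of \<open>g A\<close> fixes the letter
    \<open>p !! i\<close>, so every \<open>g A\<close> fixes the path \<open>p\<close>.\<close>
  define g where "g A i = (if fst (prod_decode i) \<in> A then t (p !! i) else 1)" for A i
  define f where "f A = germ (Elt [] (g A) []) (path_char p)" for A
  have "stream_act (g A) p = p" for A
    by (rule stream_eqI) (simp add: g_def t)
  then have "char_act (Elt [] (g A) []) (path_char p) = path_char p" for A
    using char_act_path[of "[]" "g A" "[]" p] by simp
  then have "f A \<in> isotropy ?G \<theta>" for A
    using germ_pairs_path[of _ _ "[]" p] germ_Elt_arrow[of "[]" "g A" "[]" p]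
    by (simp add: isotropy_def f_def p src_tight_germ tgt_tight_germ)
  then have sub: "range f \<subseteq> isotropy ?G \<theta>"
    by blast
  have "inj f"
  proof (rule injI)
    fix A B
    assume "f A = f B"
    then obtain n where n: "\<And>i. i \<ge> n \<Longrightarrow> g A i = g B i"
      using germ_Elt_eq_iff[of "[]" "g A" "[]" p "[]" "g B"] by (auto simp: f_def)
    have "k \<in> A \<longleftrightarrow> k \<in> B" for k
    proof -
      \<comment> \<open>The code of \<open>(k, n)\<close> is at least \<open>n\<close> and decodes
        to first component \<open>k\<close>, so agreement of the tails decides membership of
        \<open>k\<close>.\<close>
      have "g A (prod_encode (k, n)) = g B (prod_encode (k, n))"
        by (intro n le_prod_encode_2)
      then show ?thesis
        using t(2) by (auto simp: g_def split: if_splits)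
    qed
    then show "A = B" by blast
  qed
  show ?thesis
  proof
    assume "countable (isotropy ?G \<theta>)"
    then have "countable (range f)"
      using sub by (rule countable_subset[rotated])
    then have "countable (UNIV :: nat set set)"
      using \<open>inj f\<close> by (rule countable_image_inj_on)
    then show False
      using uncountable_nat_sets by blast
  qed
qed

theorem proposition6p11:
  assumes "CARD('x::finite) \<ge> 3"
  shows "hausdorff_groupoid (tight_groupoid TYPE('x isg))
    \<and> minimal_groupoid (tight_groupoid TYPE('x isg))
    \<and> effective_groupoid (tight_groupoid TYPE('x isg))
    \<and> (\<forall>\<theta>\<in>units (tight_groupoid TYPE('x isg)).
          uncountable (isotropy (tight_groupoid TYPE('x isg)) \<theta>))"
  using assms
  by (simp add: hausdorff_tight minimal_tight effective_tight uncountable_isotropy_tight)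

end
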